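(* Let $X$ be a real torus (with an integral structure). Then the following are equivalent: (i) $X$ is a tropical abelian variety; (ii) there exists a tropical line bundle on $X$ that admits a faithful embedding; (iii) there exist a tropical line bundle $L$ on $X$ and regular global sections $s_0,\dots,s_m\in H^0(X,L)\setminus\{+\infty\}$ such that the map $\varphi_{s_0,\dots,s_m}:X\to\mathbb{TP}^m$ is injective.
   Context: $\mathbb T=\mathbb R\cup\{+\infty\}$. Let $M$ be a free $\mathbb Z$-module of rank $n$, $N=\operatorname{Hom}(M,\mathbb Z)$, $N_{\mathbb R}=\operatorname{Hom}(M,\mathbb R)$, $\langle\cdot,\cdot\rangle:M\times N_{\mathbb R}\to\mathbb R$ the pairing, and $M'\subset N_{\mathbb R}$ a full lattice. $X=N_{\mathbb R}/M'$ is a real torus with integral structure $N$; $\pi:N_{\mathbb R}\to X$ is the projection. A rational polyhedral decomposition of $N_{\mathbb R}$ is a locally finite polyhedral complex covering $N_{\mathbb R}$ with cells cut out by finitely many inequalities $\langle u,x\rangle\ge b$, $u\in M$, $b\in\mathbb R$. A function is piecewise $\mathbb Z$-affine if on each cell of some such decomposition it equals $\langle u,\cdot\rangle+b$, $u\in M,b\in\mathbb R$. A regular function on $N_{\mathbb R}$ is $+\infty$ or a concave piecewise $\mathbb Z$-affine real function. A tropical descent datum is $(\lambda,\gamma)$ with $\lambda:M'\to M$ a homomorphism and $\gamma:M'\to\mathbb R$ a map with $\gamma(u_1'+u_2')-\gamma(u_1')-\gamma(u_2')=\langle\lambda(u_2'),u_1'\rangle$. The tropical line bundle $L(\lambda,\gamma)$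 is the quotient of $N_{\mathbb R}\times\mathbb T$ by $u'\cdot(x,t)=(x+u',t-\langle\lambda(u'),x\rangle-\gamma(u'))$; every tropical line bundle on $X$ is isomorphic to some $L(\lambda,\gamma)$, and its regular global sections are identified with the tropical theta functions for $(\lambda,\gamma)$: regular functions $\vartheta$ on $N_{\mathbb R}$ with $\vartheta(x+u')=\vartheta(x)-\langle\lambda(u'),x\rangle-\gamma(u')$ for all $x\in N_{\mathbb R},u'\in M'$. $X$ is a tropical abelian variety if there is a homomorphism $\lambda:M'\to M$ such that $(u_1',u_2')\mapsto\langle\lambda(u_1'),u_2'\rangle$ is symmetric and its $\mathbb R$-bilinear extension to $N_{\mathbb R}$ is positive-definite (a polarization). For $s_0,\dots,s_m\in H^0(X,L)\setminus\{+\infty\}$, $\varphi_{s_0,\dots,s_m}:X\to\mathbb R^{m+1}/\mathbb R(1,\dots,1)\subset\mathbb{TP}^m$ is $x\mapsto(s_0(\tilde x):\cdots:s_m(\tilde x))$ for any lift $\tilde x$; the target is identified with $\mathbb R^m$ via $(a_i-a_0)_{i\ge1}$. A map $\varphi:X\to\mathbb R^m$ is unimodular if there is a rational polyhedral decomposition of $N_{\mathbb R}$ on each cell of which $\varphi\circ\pi$ agrees with an affine map whose linear part extends an injective homomorphism $N\to\mathbb Z^m$ with torsion-free cokernel; it is a faithful embedding if it is unimodular and a homeomorphism onto its image. $L$ admits a faithful embedding if some such $\varphi_{s_0,\dots,s_m}$ is a faithful embedding. *)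

theory Defs
  imports "HOL-Analysis.Analysis"
begin

section \<open>The integral structure and the lattice\<close>

definition free_Z_module_of_rank :: "(int \<Rightarrow> 'm::ab_group_add \<Rightarrow> 'm) \<Rightarrow> nat \<Rightarrow> bool" where
  "free_Z_module_of_rank zscale n \<longleftrightarrow>
     module zscale \<and>
     (\<exists>B. finite B \<and> card B = n \<and> \<not> module.dependent zscale B \<and> module.span zscale B = UNIV)"

text \<open>
  The type \<open>'v\<close> stands for the real vector space of homomorphisms from \<open>M\<close> (the type \<open>'m\<close>)
  to the reals: a point \<open>x\<close> is the homomorphism \<open>\<lambda>u. pr u x\<close>, and every homomorphism arises
  from exactly one point.  For \<open>M\<close> of finite rank, \<open>'v\<close> is then finite-dimensional (possibly of
  dimension 0), so all norms on it induce the same topology; the norm is used only through that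
  topology.  Additivity of \<open>pr\<close> in the first argument is part of the second conjunct.
\<close>

definition is_real_dual :: "('m::ab_group_add \<Rightarrow> 'v::real_normed_vector \<Rightarrow> real) \<Rightarrow> bool" where
  "is_real_dual pr \<longleftrightarrow>
     (\<forall>u. linear (pr u)) \<and> bij_betw (\<lambda>x u. pr u x) UNIV {f. Modules.additive f}"

definition integral_points :: "('m::ab_group_add \<Rightarrow> 'v::real_normed_vector \<Rightarrow> real) \<Rightarrow> 'v set" where
  "integral_points pr = {x. \<forall>u. pr u x \<in> \<int>}"

definition full_lattice :: "'v::real_normed_vector set \<Rightarrow> bool" where
  "full_lattice M' \<longleftrightarrow>
     (\<exists>B. finite B \<and> independent B \<and> span B = UNIV \<and>
          M' = {(\<Sum>b\<in>B. of_int (c b) *\<^sub>R b) | c :: 'v \<Rightarrow> int. True})"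

section \<open>The real torus\<close>

definition torus_proj :: "'v::real_normed_vector set \<Rightarrow> 'v \<Rightarrow> 'v set" where
  "torus_proj M' x = (+) x ` M'"

definition torus :: "'v::real_normed_vector set \<Rightarrow> 'v set set" where
  "torus M' = range (torus_proj M')"

definition torus_topology :: "'v::real_normed_vector set \<Rightarrow> 'v set topology" where
  "torus_topology M' = topology (\<lambda>U. U \<subseteq> torus M' \<and> open (torus_proj M' -` U))"

lemma openin_torus_topology:
  "openin (torus_topology M') U \<longleftrightarrow> U \<subseteq> torus M' \<and> open (torus_proj M' -` U)"
proof -
  have "istopology (\<lambda>U. U \<subseteq> torus M' \<and> open (torus_proj M' -` U))"
    unfolding istopology_def by (auto simp: vimage_Union intro: open_Int)
  then show ?thesis
    unfolding torus_topology_def by (simp add: topology_inverse')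
qed

lemma topspace_torus_topology: "topspace (torus_topology M') = torus M'"
proof -
  have "openin (torus_topology M') (torus M')"
    unfolding openin_torus_topology by (simp add: torus_def vimage_def)
  then show ?thesis
    by (metis openin_subset openin_topspace openin_torus_topology subset_antisym)
qed

lemma quotient_map_torus_proj:
  "quotient_map euclidean (torus_topology M') (torus_proj M')"
  unfolding quotient_map_def topspace_torus_topology openin_torus_topology
  by (auto simp: torus_def vimage_def)

section \<open>Polyhedral decompositions and regular functions\<close>

definition rational_polyhedron ::
  "('m::ab_group_add \<Rightarrow> 'v::real_normed_vector \<Rightarrow> real) \<Rightarrow> 'v set \<Rightarrow> bool" where
  "rational_polyhedron pr C \<longleftrightarrow>
     (\<exists>I :: ('m \<times> real) set. finite I \<and> C = {x. \<forall>(u, b)\<in>I. pr u x \<ge> b})"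

text \<open>
  Cells are nonempty by convention.  The relation \<open>face_of\<close> of the library also counts the empty
  set as a face, so the last condition lets two cells be disjoint.
\<close>

definition rational_polyhedral_decomposition ::
  "('m::ab_group_add \<Rightarrow> 'v::real_normed_vector \<Rightarrow> real) \<Rightarrow> 'v set set \<Rightarrow> bool" where
  "rational_polyhedral_decomposition pr P \<longleftrightarrow>
     (\<forall>C\<in>P. C \<noteq> {} \<and> rational_polyhedron pr C) \<and>
     (\<forall>C\<in>P. \<forall>F. F face_of C \<and> F \<noteq> {} \<longrightarrow> F \<in> P) \<and>
     (\<forall>C\<in>P. \<forall>D\<in>P. (C \<inter> D) face_of C \<and> (C \<inter> D) face_of D) \<and>
     locally_finite_in euclidean P \<and>
     \<Union>P = UNIV"

definition piecewise_Z_affine ::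
  "('m::ab_group_add \<Rightarrow> 'v::real_normed_vector \<Rightarrow> real) \<Rightarrow> ('v \<Rightarrow> real) \<Rightarrow> bool" where
  "piecewise_Z_affine pr f \<longleftrightarrow>
     (\<exists>P. rational_polyhedral_decomposition pr P \<and>
          (\<forall>C\<in>P. \<exists>u b. \<forall>x\<in>C. f x = pr u x + b))"

text \<open>
  The values in the tropical semifield are taken in \<^typ>\<open>ereal\<close>; the value \<open>-\<infinity>\<close> never occurs.
\<close>

definition regular_function ::
  "('m::ab_group_add \<Rightarrow> 'v::real_normed_vector \<Rightarrow> real) \<Rightarrow> ('v \<Rightarrow> ereal) \<Rightarrow> bool" where
  "regular_function pr f \<longleftrightarrow>
     f = (\<lambda>_. \<infinity>) \<or>
     (\<exists>g. concave_on UNIV g \<and> piecewise_Z_affine pr g \<and> f = (\<lambda>x. ereal (g x)))"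

section \<open>Tropical line bundles and theta functions\<close>

text \<open>
  Homomorphisms on \<open>M'\<close> and the map \<open>\<gamma>\<close> are represented by functions on the whole type, of which
  only the values on \<open>M'\<close> matter.
\<close>

definition hom_on :: "'v::ab_group_add set \<Rightarrow> ('v \<Rightarrow> 'm::ab_group_add) \<Rightarrow> bool" where
  "hom_on M' l \<longleftrightarrow> (\<forall>u\<in>M'. \<forall>v\<in>M'. l (u + v) = l u + l v)"

definition tropical_descent_datum ::
  "('m::ab_group_add \<Rightarrow> 'v::real_normed_vector \<Rightarrow> real) \<Rightarrow> 'v set \<Rightarrow>
   ('v \<Rightarrow> 'm) \<Rightarrow> ('v \<Rightarrow> real) \<Rightarrow> bool" where
  "tropical_descent_datum pr M' l \<gamma> \<longleftrightarrow>
     hom_on M' l \<and>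
     (\<forall>u\<in>M'. \<forall>v\<in>M'. \<gamma> (u + v) - \<gamma> u - \<gamma> v = pr (l v) u)"

text \<open>
  Every tropical line bundle on the torus is isomorphic to some \<open>L(l, \<gamma>)\<close>, the quotient of the
  trivial bundle by \<open>u \<cdot> (x, t) = (x + u, t - pr (l u) x - \<gamma> u)\<close> for \<open>u \<in> M'\<close>.  So tropical line
  bundles are given by their descent data, and the regular global sections of \<open>L(l, \<gamma>)\<close> by the
  tropical theta functions.
\<close>

definition H0 ::
  "('m::ab_group_add \<Rightarrow> 'v::real_normed_vector \<Rightarrow> real) \<Rightarrow> 'v set \<Rightarrow>
   ('v \<Rightarrow> 'm) \<Rightarrow> ('v \<Rightarrow> real) \<Rightarrow> ('v \<Rightarrow> ereal) set" where
  "H0 pr M' l \<gamma> =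
     {\<theta>. regular_function pr \<theta> \<and>
          (\<forall>x. \<forall>u\<in>M'. \<theta> (x + u) = \<theta> x - ereal (pr (l u) x) - ereal (\<gamma> u))}"

definition finite_sections ::
  "('m::ab_group_add \<Rightarrow> 'v::real_normed_vector \<Rightarrow> real) \<Rightarrow> 'v set \<Rightarrow>
   ('v \<Rightarrow> 'm) \<Rightarrow> ('v \<Rightarrow> real) \<Rightarrow> nat \<Rightarrow> (nat \<Rightarrow> 'v \<Rightarrow> ereal) \<Rightarrow> bool" where
  "finite_sections pr M' l \<gamma> m s \<longleftrightarrow> (\<forall>i\<le>m. s i \<in> H0 pr M' l \<gamma> - {\<lambda>_. \<infinity>})"

definition tropical_abelian_variety ::
  "('m::ab_group_add \<Rightarrow> 'v::real_normed_vector \<Rightarrow> real) \<Rightarrow> 'v set \<Rightarrow> bool" where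
  "tropical_abelian_variety pr M' \<longleftrightarrow>
     (\<exists>l. hom_on M' l \<and>
          (\<forall>u\<in>M'. \<forall>v\<in>M'. pr (l u) v = pr (l v) u) \<and>
          (\<exists>Q. bilinear Q \<and> (\<forall>u\<in>M'. \<forall>v\<in>M'. Q u v = pr (l u) v) \<and>
               (\<forall>x. x \<noteq> 0 \<longrightarrow> (Q x x :: real) > 0)))"

section \<open>Maps to tropical projective space\<close>

text \<open>
  The finite part of tropical projective \<open>m\<close>-space, identified with the topological space
  \<^term>\<open>Euclidean_space m\<close>: the point \<open>(a\<^sub>0 : \<dots> : a\<^sub>m)\<close> has \<open>i\<close>-th coordinate
  \<open>a\<^bsub>i+1\<^esub> - a\<^sub>0\<close> for \<open>i < m\<close>, and coordinates from \<open>m\<close> on are 0.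
\<close>

definition proj_coords :: "nat \<Rightarrow> (nat \<Rightarrow> real) \<Rightarrow> nat \<Rightarrow> real" where
  "proj_coords m a = (\<lambda>i. if i < m then a (Suc i) - a 0 else 0)"

text \<open>The lift of a point of the torus is arbitrary; see \<open>torus_map_torus_proj\<close> below.\<close>

definition torus_map :: "nat \<Rightarrow> (nat \<Rightarrow> 'v::real_normed_vector \<Rightarrow> ereal) \<Rightarrow> 'v set \<Rightarrow> nat \<Rightarrow> real" where
  "torus_map m s c = proj_coords m (\<lambda>i. real_of_ereal (s i (SOME x. x \<in> c)))"

definition integer_points :: "nat \<Rightarrow> (nat \<Rightarrow> real) set" where
  "integer_points m = {y \<in> topspace (Euclidean_space m). \<forall>i. y i \<in> \<int>}"

definition unimodular_linear_map ::
  "('m::ab_group_add \<Rightarrow> 'v::real_normed_vector \<Rightarrow> real) \<Rightarrow> nat \<Rightarrow> ('v \<Rightarrow> nat \<Rightarrow> real) \<Rightarrow> bool" where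
  "unimodular_linear_map pr m A \<longleftrightarrow>
     range A \<subseteq> topspace (Euclidean_space m) \<and>
     (\<forall>i. linear (\<lambda>x. A x i)) \<and>
     A ` integral_points pr \<subseteq> integer_points m \<and>
     inj_on A (integral_points pr) \<and>
     (\<forall>y\<in>integer_points m. \<forall>k::int. k \<noteq> 0 \<and> (\<lambda>i. of_int k * y i) \<in> A ` integral_points pr \<longrightarrow>
        y \<in> A ` integral_points pr)"

definition unimodular ::
  "('m::ab_group_add \<Rightarrow> 'v::real_normed_vector \<Rightarrow> real) \<Rightarrow> 'v set \<Rightarrow> nat \<Rightarrow>
   ('v set \<Rightarrow> nat \<Rightarrow> real) \<Rightarrow> bool" where
  "unimodular pr M' m \<phi> \<longleftrightarrow>
     (\<exists>P. rational_polyhedral_decomposition pr P \<and>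
          (\<forall>C\<in>P. \<exists>A b. unimodular_linear_map pr m A \<and> b \<in> topspace (Euclidean_space m) \<and>
                     (\<forall>x\<in>C. \<phi> (torus_proj M' x) = (\<lambda>i. A x i + b i))))"

definition faithful_embedding ::
  "('m::ab_group_add \<Rightarrow> 'v::real_normed_vector \<Rightarrow> real) \<Rightarrow> 'v set \<Rightarrow> nat \<Rightarrow>
   ('v set \<Rightarrow> nat \<Rightarrow> real) \<Rightarrow> bool" where
  "faithful_embedding pr M' m \<phi> \<longleftrightarrow>
     unimodular pr M' m \<phi> \<and> embedding_map (torus_topology M') (Euclidean_space m) \<phi>"

definition admits_faithful_embedding ::
  "('m::ab_group_add \<Rightarrow> 'v::real_normed_vector \<Rightarrow> real) \<Rightarrow> 'v set \<Rightarrow>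
   ('v \<Rightarrow> 'm) \<Rightarrow> ('v \<Rightarrow> real) \<Rightarrow> bool" where
  "admits_faithful_embedding pr M' l \<gamma> \<longleftrightarrow>
     (\<exists>m s. finite_sections pr M' l \<gamma> m s \<and> faithful_embedding pr M' m (torus_map m s))"

lemma torus_map_torus_proj:
  assumes M': "full_lattice M'" and s: "finite_sections pr M' l \<gamma> m s"
  shows "torus_map m s (torus_proj M' x) = proj_coords m (\<lambda>i. real_of_ereal (s i x))"
proof -
  obtain B where "M' = {(\<Sum>b\<in>B. of_int (c b) *\<^sub>R b) | c :: _ \<Rightarrow> int. True}"
    using M' unfolding full_lattice_def by blast
  then have "0 \<in> M'"
    by (auto intro!: exI[of _ "\<lambda>_. 0"])
  then have "x \<in> torus_proj M' x"
    by (force simp: torus_proj_def)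
  then have "(SOME y. y \<in> torus_proj M' x) \<in> torus_proj M' x"
    by (metis someI)
  then obtain u where u: "u \<in> M'" "(SOME y. y \<in> torus_proj M' x) = x + u"
    by (auto simp: torus_proj_def)
  have shift: "real_of_ereal (s i (x + u)) = real_of_ereal (s i x) - pr (l u) x - \<gamma> u" if "i \<le> m" for i
  proof -
    have "s i \<in> H0 pr M' l \<gamma>" "s i \<noteq> (\<lambda>_. \<infinity>)"
      using s that by (auto simp: finite_sections_def)
    then obtain g where "s i = (\<lambda>x. ereal (g x))"
      "s i (x + u) = s i x - ereal (pr (l u) x) - ereal (\<gamma> u)"
      using u by (auto simp: H0_def regular_function_def)
    then show ?thesis by simp
  qed
  show ?thesis
    unfolding torus_map_def u(2) proj_coords_def by (auto simp: shift)
qed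

end

theory Submission
  imports Defs
begin

text \<open>
  From a polarization \<open>Q\<close> with \<open>q x = Q x x\<close> one gets theta functions
  \<open>min\<^sub>u (q (a + u) / 2 - Q (a + u) x)\<close>, the minimum of the tangents to \<open>- q / 2\<close> at the points of
  \<open>a + M'\<close>; up to the common summand \<open>- q / 2\<close> this is half the squared distance from \<open>x\<close> to
  \<open>a + M'\<close>.  After replacing \<open>Q\<close> by a large multiple, finitely many centres \<open>a\<close> are so dense modulo
  \<open>M'\<close> that near every \<open>x\<close> there are centres \<open>p\<close> and \<open>p + e\<close>, with \<open>e\<close> running through vectors that
  represent a basis of \<open>M\<close> under \<open>Q\<close>.  The differences of slopes then generate \<open>M\<close>, which is
  unimodularity, and the differences of distances determine \<open>x\<close> modulo \<open>M'\<close>.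

  Conversely, concavity of a single section forces the form of the bundle to be positive
  semidefinite.  If it is degenerate, some nonzero \<open>u \<in> M'\<close> has \<open>l u = 0\<close>; a concave function that
  is periodic up to a constant in the direction \<open>u\<close> is affine along it, with the same slope for
  all sections, so that no map given by sections separates the points of this line.
\<close>

section \<open>Coordinates with respect to a lattice basis\<close>

locale lattice_basis =
  fixes B :: "'v::real_normed_vector set" and M' :: "'v set"
  assumes finite_B: "finite B"
    and independent_B: "independent B"
    and span_B: "span B = UNIV"
    and lattice_eq: "M' = {(\<Sum>b\<in>B. of_int (c b) *\<^sub>R b) | c :: 'v \<Rightarrow> int. True}"
begin

definition coord :: "'v \<Rightarrow> 'v \<Rightarrow> real" where
  "coord x b = representation B x b"

lemma coord_sum: "(\<Sum>b\<in>B. coord x b *\<^sub>R b) = x"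
  unfolding coord_def
  by (rule real_vector.sum_representation_eq) (use finite_B independent_B span_B in auto)

lemma linear_coord: "linear (\<lambda>x. coord x b)"
  unfolding coord_def
  by (rule linearI) (simp_all add: real_vector.representation_add real_vector.representation_scale
      independent_B span_B)

lemmas coord_simps = linear_add[OF linear_coord] linear_diff[OF linear_coord]
  linear_neg[OF linear_coord] linear_0[OF linear_coord] linear_scale[OF linear_coord]
  linear_sum[OF linear_coord]

lemma coord_outside: "b \<notin> B \<Longrightarrow> coord x b = 0"
  unfolding coord_def using real_vector.representation_ne_zero by blast

lemma coord_basis: "b \<in> B \<Longrightarrow> coord b b' = (if b' = b then 1 else 0)"
  unfolding coord_def by (simp add: real_vector.representation_basis independent_B)

lemma coord_of_sum: "b \<in> B \<Longrightarrow> coord (\<Sum>b\<in>B. f b *\<^sub>R b) b = f b"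
  by (simp add: coord_simps coord_basis finite_B if_distrib cong: if_cong)

lemma coord_ext: "(\<And>b. b \<in> B \<Longrightarrow> coord x b = coord y b) \<Longrightarrow> x = y"
  by (metis (no_types, lifting) coord_sum sum.cong)

lemma linear_expand: "linear g \<Longrightarrow> g x = (\<Sum>b\<in>B. coord x b *\<^sub>R g b)"
  by (metis (no_types, lifting) coord_sum linear_scale linear_sum sum.cong)

lemma linear_ext:
  "linear f \<Longrightarrow> linear g \<Longrightarrow> (\<And>b. b \<in> B \<Longrightarrow> f b = g b) \<Longrightarrow> f x = g x"
  using linear_expand[of f x] linear_expand[of g x] by simp

lemma lattice_combination: "(\<Sum>b\<in>B. of_int (c b) *\<^sub>R b) \<in> M'"
  unfolding lattice_eq by auto

lemma lattice_iff: "u \<in> M' \<longleftrightarrow> (\<forall>b\<in>B. coord u b \<in> \<int>)"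
proof
  assume "u \<in> M'" then show "\<forall>b\<in>B. coord u b \<in> \<int>"
    unfolding lattice_eq by (auto simp: coord_of_sum)
next
  assume *: "\<forall>b\<in>B. coord u b \<in> \<int>"
  have "u = (\<Sum>b\<in>B. of_int \<lfloor>coord u b\<rfloor> *\<^sub>R b)"
  proof -
    have "(\<Sum>b\<in>B. of_int \<lfloor>coord u b\<rfloor> *\<^sub>R b) = (\<Sum>b\<in>B. coord u b *\<^sub>R b)"
    proof (intro sum.cong refl)
      fix b assume "b \<in> B"
      with * obtain n where "coord u b = of_int n" by (meson Ints_cases)
      then show "of_int \<lfloor>coord u b\<rfloor> *\<^sub>R b = coord u b *\<^sub>R b" by simp
    qed
    then show ?thesis by (simp add: coord_sum)
  qed
  then show "u \<in> M'" using lattice_combination[of "\<lambda>b. \<lfloor>coord u b\<rfloor>"] by simp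
qed

lemma lattice_0 [simp]: "0 \<in> M'"
  and lattice_add: "u \<in> M' \<Longrightarrow> v \<in> M' \<Longrightarrow> u + v \<in> M'"
  and lattice_diff: "u \<in> M' \<Longrightarrow> v \<in> M' \<Longrightarrow> u - v \<in> M'"
  and lattice_minus: "u \<in> M' \<Longrightarrow> - u \<in> M'"
  and lattice_basis: "b \<in> B \<Longrightarrow> b \<in> M'"
  by (auto simp: lattice_iff coord_simps coord_basis)

lemma lattice_scale: "u \<in> M' \<Longrightarrow> of_int k *\<^sub>R u \<in> M'"
  by (auto simp: lattice_iff coord_simps)

lemma full_lattice: "full_lattice M'"
  unfolding full_lattice_def using finite_B independent_B span_B lattice_eq by blast

lemma torus_proj_eq_iff: "torus_proj M' x = torus_proj M' y \<longleftrightarrow> x - y \<in> M'"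
proof
  assume "torus_proj M' x = torus_proj M' y"
  moreover have "x \<in> torus_proj M' x"
    unfolding torus_proj_def by (rule image_eqI[of _ _ 0]) auto
  ultimately show "x - y \<in> M'" by (auto simp: torus_proj_def)
next
  have sub: "torus_proj M' x \<subseteq> torus_proj M' y" if "x - y \<in> M'" for x y
  proof
    fix z assume "z \<in> torus_proj M' x"
    then obtain v where "v \<in> M'" "z = x + v" by (auto simp: torus_proj_def)
    then have "z = y + ((x - y) + v)" "(x - y) + v \<in> M'"
      by (simp_all add: lattice_add[OF that])
    then show "z \<in> torus_proj M' y" unfolding torus_proj_def by blast
  qed
  assume "x - y \<in> M'"
  then show "torus_proj M' x = torus_proj M' y"
    using sub[of x y] sub[of y x] lattice_minus[of "x - y"] by simp
qed

section \<open>Compactness and continuity read off from lattice coordinates\<close>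

definition unit_box :: "'v set" where
  "unit_box = {x. \<forall>b\<in>B. 0 \<le> coord x b \<and> coord x b \<le> 1}"

lemma exists_lattice_unit_box: "\<exists>u\<in>M'. x - u \<in> unit_box"
proof -
  let ?u = "\<Sum>b\<in>B. of_int \<lfloor>coord x b\<rfloor> *\<^sub>R b"
  have "?u \<in> M'" by (rule lattice_combination)
  moreover have "x - ?u \<in> unit_box"
    by (auto simp: unit_box_def coord_simps(2) coord_of_sum) linarith
  ultimately show ?thesis by blast
qed

lemma continuous_combination: "continuous_on UNIV (\<lambda>c::'v \<Rightarrow> real. \<Sum>b\<in>B. c b *\<^sub>R b)"
  by (intro continuous_on_sum continuous_on_scaleR continuous_on_const
      continuous_on_product_coordinates)

text \<open>The type \<open>'v\<close> is merely a normed space, so compactness comes from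
  Tychonoff's theorem for coefficient functions. These are functions on the whole type; pinning them
  to 0 off \<open>B\<close> keeps every factor compact.\<close>

lemma compact_coord_box:
  fixes a :: real
  shows "compact {c::'v \<Rightarrow> real. \<forall>b. c b \<in> (if b \<in> B then {a..d} else {0})}"
proof -
  have "compact_space (subtopology (product_topology (\<lambda>_. euclidean) UNIV)
    (PiE UNIV (\<lambda>b. if b \<in> B then {a..d} else {0::real})))"
    by (simp add: compact_space_subtopology compactin_PiE)
  then have "compactin (product_topology (\<lambda>_. euclidean) UNIV)
    (PiE UNIV (\<lambda>b. if b \<in> B then {a..d} else {0::real}))"
    by (simp add: compactin_PiE)
  then show ?thesis
    by (simp add: euclidean_product_topology PiE_def Pi_def)
qed

lemma compact_unit_box: "compact unit_box"
proof -
  let ?S = "{c::'v \<Rightarrow> real. \<forall>b. c b \<in> (if b \<in> B then {0..1} else {0})}"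
  have "unit_box = (\<lambda>c. \<Sum>b\<in>B. c b *\<^sub>R b) ` ?S"
  proof (intro set_eqI iffI)
    fix x assume "x \<in> unit_box"
    then have "coord x \<in> ?S" by (simp add: unit_box_def coord_outside)
    then show "x \<in> (\<lambda>c. \<Sum>b\<in>B. c b *\<^sub>R b) ` ?S"
      by (rule image_eqI[of _ _ "coord x", rotated]) (simp add: coord_sum)
  next
    fix x assume "x \<in> (\<lambda>c. \<Sum>b\<in>B. c b *\<^sub>R b) ` ?S"
    then obtain c where c: "c \<in> ?S" "x = (\<Sum>b\<in>B. c b *\<^sub>R b)" by blast
    have "c b \<in> {0..1}" if "b \<in> B" for b
      using c(1) that by (auto dest: spec[of _ b])
    then show "x \<in> unit_box" by (simp add: unit_box_def c(2) coord_of_sum)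
  qed
  then show ?thesis
    using compact_continuous_image[OF continuous_on_subset[OF continuous_combination] compact_coord_box]
    by auto
qed

text \<open>Stated for a quadratic gauge \<open>N\<close> so that it covers both the square of the norm and
  a positive definite quadratic form.\<close>

lemma coord_square_bound:
  fixes N :: "'v \<Rightarrow> real"
  assumes cont: "continuous_on UNIV (\<lambda>c::'v \<Rightarrow> real. N (\<Sum>b\<in>B. c b *\<^sub>R b))"
    and scale: "\<And>t x. N (t *\<^sub>R x) = t\<^sup>2 * N x"
    and pos: "\<And>x. x \<noteq> 0 \<Longrightarrow> N x > 0"
  shows "\<exists>K>0. \<forall>x b. (coord x b)\<^sup>2 \<le> K * N x"
proof -
  let ?F = "\<lambda>c::'v \<Rightarrow> real. N (\<Sum>b\<in>B. c b *\<^sub>R b)"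
  let ?S = "{c::'v \<Rightarrow> real. \<forall>b. c b \<in> (if b \<in> B then {-1..1} else {0})} \<inter> (\<Union>b\<in>B. {c. \<bar>c b\<bar> = 1})"
  have N0: "N 0 = 0" using scale[of 0 0] by simp
  have closed: "closed (\<Union>b\<in>B. {c::'v \<Rightarrow> real. \<bar>c b\<bar> = 1})"
    by (intro closed_UN finite_B ballI closed_Collect_eq continuous_intros
        continuous_on_product_coordinates)
  have S: "compact ?S"
    by (intro compact_Int_closed compact_coord_box closed)
  \<comment> \<open>\<open>?S\<close> is the unit sphere of the maximum norm in coordinates, and
    \<open>\<delta>\<close> is the minimum of \<open>N\<close> there. The sphere is empty exactly in
    dimension 0, where any positive \<open>\<delta>\<close> serves.\<close>
  have "\<exists>\<delta>>0. \<forall>c\<in>?S. \<delta> \<le> ?F c"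
  proof (cases "?S = {}")
    case False
    then obtain c0 where c0: "c0 \<in> ?S" "\<And>c. c \<in> ?S \<Longrightarrow> ?F c0 \<le> ?F c"
      using continuous_attains_inf[OF S _ continuous_on_subset[OF cont]] by blast
    then obtain b where "b \<in> B" "\<bar>c0 b\<bar> = 1" by blast
    then have "(\<Sum>b\<in>B. c0 b *\<^sub>R b) \<noteq> 0"
      using coord_of_sum[of b c0] coord_simps(4)[of b] by fastforce
    then have "?F c0 > 0" by (rule pos)
    then show ?thesis using c0(2) by blast
  next
    case True
    then show ?thesis by (intro exI[of _ 1]) simp
  qed
  then obtain \<delta> where \<delta>: "\<delta> > 0" "\<And>c. c \<in> ?S \<Longrightarrow> \<delta> \<le> ?F c" by blast
  have "(coord x b)\<^sup>2 \<le> (1 / \<delta>) * N x" for x b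
  proof (cases "coord x b = 0")
    case True
    then show ?thesis using pos[of x] N0 \<delta> by (cases "x = 0") auto
  next
    case False
    then have b: "b \<in> B" using coord_outside by blast
    define t where "t = Max ((\<lambda>b. \<bar>coord x b\<bar>) ` B)"
    have t: "\<bar>coord x b'\<bar> \<le> t" if "b' \<in> B" for b'
      unfolding t_def using that finite_B by simp
    have "t > 0" using t[OF b] False by linarith
    have "t \<in> (\<lambda>b. \<bar>coord x b\<bar>) ` B"
      unfolding t_def using finite_B b by (intro Max_in) auto
    then obtain b' where b': "b' \<in> B" "t = \<bar>coord x b'\<bar>" by blast
    let ?c = "\<lambda>b. coord x b / t"
    have "?c a \<in> {-1..1}" if "a \<in> B" for a
      using t[OF that] \<open>t > 0\<close> by (auto simp: field_simps)
    then have "?c a \<in> (if a \<in> B then {-1..1} else {0})" for a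
      using coord_outside[of a] by simp
    moreover have "\<bar>?c b'\<bar> = 1" using b' \<open>t > 0\<close> by simp
    ultimately have "?c \<in> ?S" using b'(1) by blast
    then have "\<delta> \<le> ?F ?c" by (rule \<delta>(2))
    also have "(\<Sum>b\<in>B. ?c b *\<^sub>R b) = (1 / t) *\<^sub>R (\<Sum>b\<in>B. coord x b *\<^sub>R b)"
      by (simp add: scaleR_sum_right)
    also have "\<dots> = (1 / t) *\<^sub>R x"
      by (simp only: coord_sum)
    also have "N \<dots> = N x / t\<^sup>2" by (simp add: scale power_divide)
    finally have "\<delta> * t\<^sup>2 \<le> N x" using \<open>t > 0\<close> by (simp add: field_simps)
    moreover have "(coord x b)\<^sup>2 \<le> t\<^sup>2" using t[OF b] by (metis abs_ge_zero power2_abs power_mono)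
    ultimately have "\<delta> * (coord x b)\<^sup>2 \<le> N x" using \<delta>(1) by (meson mult_left_mono order.trans less_imp_le)
    then show ?thesis using \<delta>(1) by (simp add: field_simps)
  qed
  then show ?thesis using \<delta>(1) by (intro exI[of _ "1 / \<delta>"]) simp
qed

text \<open>On a general normed space a linear functional may be unbounded. Here
  \<open>coord_square_bound\<close>, applied to the square of the norm, bounds every coordinate, and
  a functional is a finite combination of coordinates.\<close>

lemma continuous_linear:
  fixes g :: "'v \<Rightarrow> real"
  assumes "linear g"
  shows "continuous_on UNIV g"
proof -
  have "\<exists>K>0. \<forall>x b. (coord x b)\<^sup>2 \<le> K * (norm x)\<^sup>2"
    by (rule coord_square_bound)
      (auto simp: power_mult_distrib intro!: continuous_on_power continuous_on_norm continuous_combination)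
  then obtain K where K: "K > 0" "\<And>x b. (coord x b)\<^sup>2 \<le> K * (norm x)\<^sup>2" by blast
  have *: "\<bar>coord x b\<bar> \<le> norm x * sqrt K" for x b
    using real_sqrt_le_mono[OF K(2)[of x b]] K(1) by (simp add: real_sqrt_mult mult.commute)
  have "bounded_linear (\<lambda>x. coord x b)" for b
    by (rule bounded_linear_intro[where K = "sqrt K"]) (auto simp: coord_simps *)
  then have "bounded_linear (\<lambda>x. \<Sum>b\<in>B. coord x b *\<^sub>R g b)"
    by (intro bounded_linear_sum bounded_linear_scaleR_const)
  moreover have "g = (\<lambda>x. \<Sum>b\<in>B. coord x b *\<^sub>R g b)"
    using linear_expand[OF assms] by blast
  ultimately have "bounded_linear g" by simp
  then show ?thesis by (simp add: linear_continuous_on)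
qed

end

section \<open>Decompositions induced by minima of affine functions\<close>

text \<open>The index set \<open>J\<close> is partitioned by \<open>grp\<close>; each group represents one concave function, the
  minimum of its members.  Several functions are treated at once so that the cells form a common
  decomposition for all of them.\<close>

locale affine_family =
  fixes pr :: "'m::ab_group_add \<Rightarrow> 'v::real_normed_vector \<Rightarrow> real"
    and J :: "'j set" and grp :: "'j \<Rightarrow> 'g" and slope :: "'j \<Rightarrow> 'm" and const :: "'j \<Rightarrow> real"
  assumes linear_pr: "linear (pr u)"
    and continuous_pr: "continuous_on UNIV (pr u)"
    and pr_diff: "pr (u - u') x = pr u x - pr u' x"
begin

definition aff :: "'j \<Rightarrow> 'v \<Rightarrow> real" where
  "aff j x = pr (slope j) x + const j"

definition active :: "'v \<Rightarrow> 'j set" where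
  "active x = {j\<in>J. \<forall>j'\<in>J. grp j' = grp j \<longrightarrow> aff j x \<le> aff j' x}"

text \<open>Cells are labelled by points: \<open>cell x\<close> is the smallest cell containing
  \<open>x\<close>, and different labels may give the same cell.\<close>

definition cell :: "'v \<Rightarrow> 'v set" where
  "cell x = {y. active x \<subseteq> active y}"

lemma aff_segment: "aff j ((1 - t) *\<^sub>R a + t *\<^sub>R b) = (1 - t) * aff j a + t * aff j b"
  unfolding aff_def[abs_def]
  by (simp add: linear_add[OF linear_pr] linear_scale[OF linear_pr] del: scaleR_left_diff_distrib)
    (simp add: algebra_simps)

lemma continuous_aff: "continuous_on UNIV (aff j)"
  unfolding aff_def[abs_def] by (intro continuous_on_add continuous_pr continuous_on_const)

lemma activeD: "j \<in> active x \<Longrightarrow> j' \<in> J \<Longrightarrow> grp j' = grp j \<Longrightarrow> aff j x \<le> aff j' x"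
  and active_subset: "active x \<subseteq> J"
  by (auto simp: active_def)

lemma active_transfer:
  "j' \<in> active x \<Longrightarrow> j \<in> J \<Longrightarrow> grp j = grp j' \<Longrightarrow> aff j x \<le> aff j' x \<Longrightarrow> j \<in> active x"
  by (fastforce simp: active_def)

lemma cell_self: "x \<in> cell x"
  by (simp add: cell_def)

lemma cell_eq:
  "cell x = (\<Inter>j\<in>active x. \<Inter>j'\<in>{j'\<in>J. grp j' = grp j}. {y. aff j y \<le> aff j' y})"
proof -
  have "j \<in> active y \<longleftrightarrow> (\<forall>j'\<in>J. grp j' = grp j \<longrightarrow> aff j y \<le> aff j' y)" if "j \<in> active x" for j y
    using that by (auto simp: active_def)
  then show ?thesis unfolding cell_def by blast
qed

lemma closed_cell: "closed (cell x)"
  unfolding cell_eq by (intro closed_INT ballI closed_Collect_le continuous_aff)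

end

text \<open>The set \<open>J\<close> may be infinite. \<open>attained\<close> makes the minima
  exist, \<open>locally_finite\<close> makes the cells locally finite, and
  \<open>finite_on_cell\<close> leaves finitely many inequalities for each cell.\<close>

locale locally_finite_family = affine_family pr J grp slope const
  for pr :: "'m::ab_group_add \<Rightarrow> 'v::real_normed_vector \<Rightarrow> real"
    and J :: "'j set" and grp :: "'j \<Rightarrow> 'g" and slope :: "'j \<Rightarrow> 'm" and const :: "'j \<Rightarrow> real" +
  assumes attained: "j \<in> J \<Longrightarrow> \<exists>j'\<in>active x. grp j' = grp j"
    and locally_finite: "\<exists>U. open U \<and> x \<in> U \<and> finite (\<Union>y\<in>U. active y)"
    and finite_on_cell: "finite (\<Union>y\<in>cell x. active y)"
begin

lemma finite_active: "finite (active x)"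
  by (rule finite_subset[OF _ finite_on_cell[of x]]) (use cell_self in blast)

text \<open>Only finitely many indices are ever active near \<open>x\<close>. Each of them that is
  inactive at \<open>x\<close> is beaten strictly there by an active one, and by continuity also
  nearby.\<close>

lemma active_upper_semicontinuous: "\<exists>V. open V \<and> x \<in> V \<and> (\<forall>y\<in>V. active y \<subseteq> active x)"
proof -
  obtain U where U: "open U" "x \<in> U" "finite (\<Union>y\<in>U. active y)"
    using locally_finite by blast
  let ?F = "(\<Union>y\<in>U. active y) - active x"
  have "\<exists>W. open W \<and> x \<in> W \<and> (\<forall>y\<in>W. j \<notin> active y)" if "j \<in> ?F" for j
  proof -
    have j: "j \<in> J" "j \<notin> active x" using that active_subset by blast+
    then obtain j0 where j0: "j0 \<in> active x" "grp j0 = grp j" using attained by blast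
    then have "aff j0 x < aff j x"
      using active_transfer[OF j0(1) j(1) j0(2)[symmetric]] j(2) by linarith
    moreover have "open {y. aff j0 y < aff j y}"
      by (intro open_Collect_less continuous_aff)
    moreover have "j \<notin> active y" if "aff j0 y < aff j y" for y
    proof
      assume "j \<in> active y"
      moreover have "j0 \<in> J" using j0(1) active_subset by blast
      ultimately show False using activeD[of j y j0] j0(2) that by linarith
    qed
    ultimately show ?thesis by (intro exI[of _ "{y. aff j0 y < aff j y}"]) simp
  qed
  then have "\<exists>W. \<forall>j\<in>?F. open (W j) \<and> x \<in> W j \<and> (\<forall>y\<in>W j. j \<notin> active y)"
    by (intro bchoice ballI)
  then obtain W where W: "\<And>j. j \<in> ?F \<Longrightarrow> open (W j) \<and> x \<in> W j \<and> (\<forall>y\<in>W j. j \<notin> active y)"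
    by blast
  have "open (U \<inter> (\<Inter>j\<in>?F. W j))"
    by (intro open_Int open_INT U(1) finite_Diff U(3) ballI conjunct1[OF W])
  moreover have "x \<in> U \<inter> (\<Inter>j\<in>?F. W j)" using U(2) W by blast
  moreover have "active y \<subseteq> active x" if "y \<in> U \<inter> (\<Inter>j\<in>?F. W j)" for y
  proof
    fix j assume "j \<in> active y"
    then have "j \<notin> ?F" using that W[of j] by blast
    then show "j \<in> active x" using that \<open>j \<in> active y\<close> by blast
  qed
  ultimately show ?thesis by blast
qed

text \<open>Take \<open>p\<close> in the group of \<open>j\<close> and active on all of
  \<open>cell x\<close>. The difference of \<open>aff j\<close> and \<open>aff p\<close> is
  nonnegative at both ends and at most 0 at the inner point \<open>z\<close>; being affine, it
  vanishes at both ends.\<close>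

lemma active_on_segment:
  assumes "a \<in> cell x" "b \<in> cell x" "z \<in> open_segment a b"
  shows "active z \<subseteq> active a \<inter> active b"
proof
  fix j assume j: "j \<in> active z"
  obtain t where t: "0 < t" "t < 1" "z = (1 - t) *\<^sub>R a + t *\<^sub>R b"
    using assms(3) by (auto simp: in_segment)
  have "j \<in> J" using j active_subset by blast
  then obtain p where p: "p \<in> active x" "grp p = grp j" using attained by blast
  then have pab: "p \<in> active a" "p \<in> active b" "p \<in> J"
    using assms active_subset by (auto simp: cell_def)
  have ge: "aff p a \<le> aff j a" "aff p b \<le> aff j b"
    using activeD[OF pab(1) \<open>j \<in> J\<close>] activeD[OF pab(2) \<open>j \<in> J\<close>] p(2) by simp_all
  have "aff j z \<le> aff p z" using activeD[OF j] pab p by auto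
  then have "(1 - t) * (aff j a - aff p a) + t * (aff j b - aff p b) \<le> 0"
    unfolding t aff_segment by (simp add: algebra_simps)
  moreover have "(1 - t) * (aff j a - aff p a) \<ge> 0" "t * (aff j b - aff p b) \<ge> 0"
    using ge t by auto
  ultimately have "(1 - t) * (aff j a - aff p a) = 0" "t * (aff j b - aff p b) = 0"
    by linarith+
  then have "aff j a \<le> aff p a" "aff j b \<le> aff p b"
    using t by auto
  then show "j \<in> active a \<inter> active b"
    using active_transfer[OF pab(1) \<open>j \<in> J\<close>] active_transfer[OF pab(2) \<open>j \<in> J\<close>] p(2) by simp
qed

lemma convex_cell: "convex (cell x)"
proof -
  have "convex {y. aff j y \<le> aff j' y}" for j j'
  proof (rule convexI)
    fix a b and u v :: real
    assume *: "a \<in> {y. aff j y \<le> aff j' y}" "b \<in> {y. aff j y \<le> aff j' y}"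
      "0 \<le> u" "0 \<le> v" "u + v = 1"
    then have "u = 1 - v" by simp
    with * show "u *\<^sub>R a + v *\<^sub>R b \<in> {y. aff j y \<le> aff j' y}"
      by (auto simp: aff_segment intro!: add_mono mult_left_mono)
  qed
  then show ?thesis unfolding cell_eq by (intro convex_INT)
qed

text \<open>Comparisons with the finitely many indices in \<open>G\<close>, those active somewhere
  on the cell, already cut it out. Otherwise a segment from \<open>x\<close> to a point of
  \<open>D\<close> would leave the cell, and just after the exit only indices of \<open>G\<close>
  could be active.\<close>

lemma rational_polyhedron_cell: "rational_polyhedron pr (cell x)"
proof -
  define G where "G = (\<Union>y\<in>cell x. active y)"
  define I where "I = (\<lambda>(j, j'). (slope j' - slope j, const j - const j')) `
    {(j, j') \<in> active x \<times> G. grp j = grp j'}"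
  have "finite G" unfolding G_def by (rule finite_on_cell)
  then have "finite {(j, j') \<in> active x \<times> G. grp j = grp j'}"
    by (intro finite_subset[OF _ finite_cartesian_product[OF finite_active[of x]]]) auto
  then have "finite I" unfolding I_def by (rule finite_imageI)
  have G_J: "G \<subseteq> J" unfolding G_def using active_subset by blast
  define D where "D = {y. \<forall>j\<in>active x. \<forall>j'\<in>G. grp j = grp j' \<longrightarrow> aff j y \<le> aff j' y}"
  have "{y. \<forall>(u, b)\<in>I. pr u y \<ge> b} = D"
  proof (intro set_eqI)
    fix y
    have "const j - const j' \<le> pr (slope j' - slope j) y \<longleftrightarrow> aff j y \<le> aff j' y" for j j'
      by (simp add: pr_diff aff_def algebra_simps)
    then show "y \<in> {y. \<forall>(u, b)\<in>I. pr u y \<ge> b} \<longleftrightarrow> y \<in> D"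
      unfolding I_def D_def by auto
  qed
  moreover have "cell x = D"
  proof
    show "cell x \<subseteq> D"
    proof
      fix y assume y: "y \<in> cell x"
      have "aff j y \<le> aff j' y" if "j \<in> active x" "j' \<in> G" "grp j = grp j'" for j j'
        using activeD[of j y j'] that y G_J by (auto simp: cell_def)
      then show "y \<in> D" by (auto simp: D_def)
    qed
  next
    show "D \<subseteq> cell x"
    proof
      fix y assume y: "y \<in> D"
      let ?p = "\<lambda>t. (1 - t) *\<^sub>R x + t *\<^sub>R y"
      let ?T = "{0..1} \<inter> ?p -` cell x"
      have contp: "continuous_on UNIV ?p" by (intro continuous_intros)
      have "compact ?T"
        by (intro compact_Int_closed compact_Icc closed_vimage closed_cell contp)
      moreover have "0 \<in> ?T" using cell_self by simp
      ultimately obtain t where t: "t \<in> ?T" "\<And>s. s \<in> ?T \<Longrightarrow> s \<le> t"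
        using compact_attains_sup[of ?T] by blast
      have "t = 1"
      proof (rule ccontr)
        assume "t \<noteq> 1"
        with t have "0 \<le> t" "t < 1" by auto
        obtain V where V: "open V" "?p t \<in> V" "\<And>z. z \<in> V \<Longrightarrow> active z \<subseteq> active (?p t)"
          using active_upper_semicontinuous[of "?p t"] by blast
        have "open (?p -` V)" using open_vimage[OF V(1) contp] .
        moreover have "t \<in> ?p -` V" using V(2) by simp
        ultimately obtain e where e: "e > 0" "ball t e \<subseteq> ?p -` V"
          unfolding open_contains_ball by blast
        define s where "s = min 1 (t + e / 2)"
        have s: "t < s" "s \<le> 1" "s \<in> ball t e"
          using \<open>t < 1\<close> e by (auto simp: s_def dist_real_def min_def)
        then have sV: "?p s \<in> V" using e by auto
        \<comment> \<open>The inequalities of \<open>D\<close> hold at both ends of the segment,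
          hence at \<open>?p s\<close>, and they include the comparison with the active index
          \<open>j0\<close>. So the cell reaches beyond the last parameter \<open>t\<close>.\<close>
        have "active x \<subseteq> active (?p s)"
        proof
          fix j assume j: "j \<in> active x"
          then have "j \<in> J" using active_subset by blast
          then obtain j0 where j0: "j0 \<in> active (?p s)" "grp j0 = grp j" using attained by blast
          then have "j0 \<in> G" using V(3)[OF sV] t(1) unfolding G_def by blast
          then have "aff j y \<le> aff j0 y" "aff j x \<le> aff j0 x"
            using y j j0 activeD[OF j] G_J unfolding D_def by auto
          then have "aff j (?p s) \<le> aff j0 (?p s)"
            unfolding aff_segment using s \<open>0 \<le> t\<close> by (intro add_mono mult_left_mono) auto
          then show "j \<in> active (?p s)"
            by (rule active_transfer[OF j0(1) \<open>j \<in> J\<close> j0(2)[symmetric]])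
        qed
        then have "s \<in> ?T" using s \<open>0 \<le> t\<close> by (auto simp: cell_def)
        then show False using t(2) s by fastforce
      qed
      then show "y \<in> cell x" using t by simp
    qed
  qed
  ultimately show ?thesis
    unfolding rational_polyhedron_def using \<open>finite I\<close> by blast
qed

lemma cell_Int_face_of: "(cell x \<inter> cell y) face_of cell x"
proof -
  have *: "a \<in> cell y \<and> b \<in> cell y"
    if "a \<in> cell x" "b \<in> cell x" "z \<in> cell y" "z \<in> open_segment a b" for a b z
  proof -
    have "active y \<subseteq> active z" using that(3) by (simp add: cell_def)
    then show ?thesis
      using active_on_segment[OF that(1,2,4)] unfolding cell_def by blast
  qed
  have "convex (cell x \<inter> cell y)" by (intro convex_Int convex_cell)
  then show ?thesis
    unfolding face_of_def using * by blast
qed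

text \<open>A face is the cell of any of its points with as few active indices as possible.\<close>

lemma face_of_cell:
  assumes F: "F face_of cell x" and "F \<noteq> {}"
  shows "\<exists>z. F = cell z"
proof -
  obtain z where z: "z \<in> F" "\<And>w. w \<in> F \<Longrightarrow> card (active z) \<le> card (active w)"
    using ex_has_least_nat[of "\<lambda>z. z \<in> F" _ "\<lambda>z. card (active z)"] \<open>F \<noteq> {}\<close> by blast
  have Fx: "F \<subseteq> cell x" and convF: "convex F" using F by (auto simp: face_of_def)
  have "F \<subseteq> cell z"
  proof
    fix w assume w: "w \<in> F"
    show "w \<in> cell z"
    proof (cases "w = z")
      case False
      let ?m = "midpoint z w"
      have m: "?m \<in> open_segment z w" using False by simp
      then have mF: "?m \<in> F"
        using convF w z(1) convex_contains_open_segment[of F] by blast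
      have sub: "active ?m \<subseteq> active z \<inter> active w"
        using active_on_segment[OF _ _ m] w z(1) Fx by blast
      have "active ?m = active z"
        using card_seteq[OF finite_active, of "active ?m" z] sub z(2)[OF mF] by blast
      then show ?thesis using sub by (auto simp: cell_def)
    qed (simp add: cell_self)
  qed
  moreover have "cell z \<subseteq> F"
  proof
    fix y assume y: "y \<in> cell z"
    show "y \<in> F"
    proof (cases "y = z")
      case False
      obtain V where V: "open V" "z \<in> V" "\<And>v. v \<in> V \<Longrightarrow> active v \<subseteq> active z"
        using active_upper_semicontinuous[of z] by blast
      let ?p = "\<lambda>t. (1 - t) *\<^sub>R z + t *\<^sub>R y"
      have "continuous_on UNIV ?p" by (intro continuous_intros)
      then have "open (?p -` V)" by (rule open_vimage[OF V(1)])
      moreover have "0 \<in> ?p -` V" using V(2) by simp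
      ultimately obtain e where e: "e > 0" "ball 0 e \<subseteq> ?p -` V"
        unfolding open_contains_ball by blast
      \<comment> \<open>A negative parameter prolongs the segment from \<open>y\<close> to
        \<open>z\<close> slightly beyond \<open>z\<close>. The new point still lies in
        \<open>cell x\<close>, so \<open>z\<close> is interior to a segment of that cell and the
        face property brings \<open>y\<close> into \<open>F\<close>.\<close>
      define t where "t = - e / 2"
      have "t \<in> ball 0 e" using e(1) by (simp add: t_def)
      then have "?p t \<in> V" using e(2) by blast
      moreover have "t < 0" using e(1) by (simp add: t_def)
      ultimately have t: "t < 0" "?p t \<in> V" by auto
      have "active z \<subseteq> active (?p t)"
      proof
        fix j assume j: "j \<in> active z"
        then have "j \<in> J" using active_subset by blast
        then obtain j' where j': "j' \<in> active (?p t)" "grp j' = grp j" using attained by blast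
        then have "j' \<in> active z" "j' \<in> J" using V(3)[OF t(2)] active_subset by auto
        then have "j' \<in> active y" "j \<in> active y" using y j by (auto simp: cell_def)
        then have "aff j z = aff j' z" "aff j y = aff j' y"
          using activeD[OF j \<open>j' \<in> J\<close> j'(2)] activeD[OF \<open>j' \<in> active z\<close> \<open>j \<in> J\<close> j'(2)[symmetric]]
            activeD[OF \<open>j \<in> active y\<close> \<open>j' \<in> J\<close> j'(2)]
            activeD[OF \<open>j' \<in> active y\<close> \<open>j \<in> J\<close> j'(2)[symmetric]] by linarith+
        then have "aff j (?p t) = aff j' (?p t)" unfolding aff_segment by simp
        then show "j \<in> active (?p t)"
          by (intro active_transfer[OF j'(1) \<open>j \<in> J\<close> j'(2)[symmetric]]) simp
      qed
      then have "?p t \<in> cell x" using z(1) Fx by (auto simp: cell_def)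
      moreover have "y \<in> cell x" using y z(1) Fx by (auto simp: cell_def)
      moreover have "z \<in> open_segment y (?p t)"
      proof -
        define s where "s = 1 / (1 - t)"
        have s: "s * (1 - t) = 1" "0 < s" "s < 1" using t by (auto simp: s_def field_simps)
        have "(1 - s) *\<^sub>R y + s *\<^sub>R ?p t = (1 - s * (1 - t)) *\<^sub>R y + (s * (1 - t)) *\<^sub>R z"
          by (simp add: algebra_simps)
        then have "z = (1 - s) *\<^sub>R y + s *\<^sub>R ?p t" by (simp add: s(1))
        moreover have "y \<noteq> ?p t"
        proof
          assume "y = ?p t"
          then have "(1 - t) *\<^sub>R (y - z) = 0" by (simp add: algebra_simps)
          then show False using False t by simp
        qed
        ultimately show ?thesis using s unfolding in_segment by blast
      qed
      ultimately show "y \<in> F" using F z(1) unfolding face_of_def by blast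
    qed (simp add: z)
  qed
  ultimately show ?thesis by blast
qed

lemma rational_polyhedral_decomposition_cells: "rational_polyhedral_decomposition pr (range cell)"
  unfolding rational_polyhedral_decomposition_def
proof (intro conjI ballI allI impI)
  show "C \<noteq> {}" if "C \<in> range cell" for C using that cell_self by auto
  show "rational_polyhedron pr C" if "C \<in> range cell" for C
    using that rational_polyhedron_cell by blast
  show "F \<in> range cell" if "C \<in> range cell" "F face_of C \<and> F \<noteq> {}" for C F
    using that face_of_cell by blast
  show "C \<inter> D face_of C" if "C \<in> range cell" "D \<in> range cell" for C D
    using that cell_Int_face_of by blast
  show "C \<inter> D face_of D" if "C \<in> range cell" "D \<in> range cell" for C D
    using that cell_Int_face_of by (metis Int_commute imageE)
  show "\<Union> (range cell) = UNIV" using cell_self by blast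
  show "locally_finite_in euclidean (range cell)"
    unfolding locally_finite_in_def
  proof (intro conjI ballI)
    fix x :: 'v
    obtain U where U: "open U" "x \<in> U" "finite (\<Union>y\<in>U. active y)"
      using locally_finite by blast
    \<comment> \<open>A cell is determined by the active set of its label, and if the cell meets
      \<open>U\<close>, that set lies inside a fixed finite one.\<close>
    have "{C \<in> range cell. C \<inter> U \<noteq> {}} \<subseteq> (\<lambda>T. {y. T \<subseteq> active y}) ` Pow (\<Union>y\<in>U. active y)"
      by (auto simp: cell_def)
    then have "finite {C \<in> range cell. C \<inter> U \<noteq> {}}"
      using U(3) by (meson finite_Pow_iff finite_imageI finite_subset)
    then show "\<exists>V. openin euclidean V \<and> x \<in> V \<and> finite {C \<in> range cell. C \<inter> V \<noteq> {}}"
      using U by auto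
  qed auto
qed

end

section \<open>Polarized lattices\<close>

locale real_dual =
  fixes pr :: "'m::ab_group_add \<Rightarrow> 'v::real_normed_vector \<Rightarrow> real"
  assumes real_dual: "is_real_dual pr"
begin

lemma linear_pr: "linear (pr u)"
  using real_dual by (simp add: is_real_dual_def)

lemma additive_pr: "Modules.additive (\<lambda>u. pr u x)"
proof -
  have "(\<lambda>x u. pr u x) ` UNIV = {f. Modules.additive f}"
    using real_dual by (simp add: is_real_dual_def bij_betw_def)
  then show ?thesis by auto
qed

lemmas pr_add = additive.add[OF additive_pr]
  and pr_diff = additive.diff[OF additive_pr]
  and pr_minus = additive.minus[OF additive_pr]
  and pr_0 = additive.zero[OF additive_pr]

lemma point_eqI:
  assumes "\<And>u. pr u x = pr u y"
  shows "x = y"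
proof -
  have "inj (\<lambda>x u. pr u x)"
    using real_dual by (simp add: is_real_dual_def bij_betw_def)
  moreover have "(\<lambda>u. pr u x) = (\<lambda>u. pr u y)" using assms by blast
  ultimately show ?thesis by (rule injD)
qed

lemma exists_point:
  assumes "Modules.additive f"
  obtains x where "\<And>u. pr u x = f u"
proof -
  have "(\<lambda>x u. pr u x) ` UNIV = {f. Modules.additive f}"
    using real_dual by (simp add: is_real_dual_def bij_betw_def)
  then have "f \<in> (\<lambda>x u. pr u x) ` UNIV" using assms by simp
  then show ?thesis using that by auto
qed

lemma pr_zscale:
  assumes "module zscale"
  shows "pr (zscale k u) x = of_int k * pr u x"
proof -
  interpret module zscale by fact
  have nat: "pr (zscale (int n) u) x = of_nat n * pr u x" for n
    by (induction n) (simp_all add: scale_left_distrib pr_add pr_0 algebra_simps)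
  show ?thesis
  proof (cases k)
    case (neg n)
    then show ?thesis using nat[of "Suc n"] by (simp only: scale_minus_left pr_minus)
  qed (simp add: nat)
qed

end

locale polarized_lattice = lattice_basis B M' + real_dual pr
  for B M' :: "'v::real_normed_vector set" and pr :: "'m::ab_group_add \<Rightarrow> 'v \<Rightarrow> real" +
  fixes Q :: "'v \<Rightarrow> 'v \<Rightarrow> real" and l :: "'v \<Rightarrow> 'm"
  assumes hom_l: "hom_on M' l"
    and bilinear_Q: "bilinear Q"
    and sym_Q: "Q x y = Q y x"
    and pos_Q: "x \<noteq> 0 \<Longrightarrow> Q x x > 0"
    and Q_lattice: "u \<in> M' \<Longrightarrow> Q u x = pr (l u) x"
begin

lemmas Q_simps = bilinear_ladd[OF bilinear_Q] bilinear_radd[OF bilinear_Q]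
  bilinear_lsub[OF bilinear_Q] bilinear_rsub[OF bilinear_Q]
  bilinear_lneg[OF bilinear_Q] bilinear_rneg[OF bilinear_Q]
  bilinear_lmul[OF bilinear_Q] bilinear_rmul[OF bilinear_Q]
  bilinear_lzero[OF bilinear_Q] bilinear_rzero[OF bilinear_Q]

definition q :: "'v \<Rightarrow> real" where
  "q x = Q x x"

lemma q_0 [simp]: "q 0 = 0"
  and q_minus: "q (- x) = q x"
  and q_scale: "q (t *\<^sub>R x) = t\<^sup>2 * q x"
  by (simp_all add: q_def Q_simps power2_eq_square)

lemma q_pos: "x \<noteq> 0 \<Longrightarrow> q x > 0"
  unfolding q_def by (rule pos_Q)

lemma q_nonneg: "q x \<ge> 0"
  by (cases "x = 0") (auto dest: q_pos)

lemma q_add: "q (x + y) = q x + 2 * Q x y + q y"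
  and q_diff: "q (x - y) = q x - 2 * Q x y + q y"
  using sym_Q[of x y] by (simp_all add: q_def Q_simps)

lemma q_diff_le: "q (x - y) \<le> 2 * q x + 2 * q y"
  using q_nonneg[of "x + y"] by (simp add: q_add q_diff)

lemma linear_Q: "linear (Q x)"
  using bilinear_Q by (simp add: bilinear_def)

lemma continuous_q: "continuous_on UNIV q"
proof -
  have "q = (\<lambda>x. \<Sum>b\<in>B. coord x b * Q b x)"
  proof
    fix x
    have "linear (\<lambda>y. Q y x)" using bilinear_Q by (simp add: bilinear_def)
    from linear_expand[OF this, of x] show "q x = (\<Sum>b\<in>B. coord x b * Q b x)"
      by (simp add: q_def)
  qed
  then show ?thesis
    by (simp only:)
      (intro continuous_on_sum continuous_on_mult continuous_linear linear_coord linear_Q)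
qed

lemma coord_q_bound: "\<exists>K>0. \<forall>x b. (coord x b)\<^sup>2 \<le> K * q x"
proof (rule coord_square_bound)
  show "continuous_on UNIV (\<lambda>c::'v \<Rightarrow> real. q (\<Sum>b\<in>B. c b *\<^sub>R b))"
    by (rule continuous_on_compose2[OF continuous_q continuous_combination]) simp
qed (rule q_scale, rule q_pos)

lemma finite_lattice_ball: "finite {u \<in> M'. q (z - u) \<le> r}"
proof -
  obtain K where K: "K > 0" "\<And>x b. (coord x b)\<^sup>2 \<le> K * q x"
    using coord_q_bound by blast
  \<comment> \<open>The summand 1 allows the passage from squares to absolute values through
    \<open>2 * \<bar>c\<bar> \<le> c\<^sup>2 + 1\<close>.\<close>
  define N where "N = \<lceil>1 + K * (2 * q z + 2 * r)\<rceil>"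
  have "{u \<in> M'. q (z - u) \<le> r} \<subseteq>
    (\<lambda>c. \<Sum>b\<in>B. of_int (c b) *\<^sub>R b) ` (PiE B (\<lambda>_. {-N..N}))"
  proof
    fix u assume u: "u \<in> {u \<in> M'. q (z - u) \<le> r}"
    then have "q u \<le> 2 * q z + 2 * r" using q_diff_le[of z "z - u"] by simp
    then have "K * q u \<le> K * (2 * q z + 2 * r)"
      using K(1) by (intro mult_left_mono) auto
    then have sq: "(coord u b)\<^sup>2 \<le> of_int N - 1" for b
      using K(2)[of u b] unfolding N_def by linarith
    have "\<bar>coord u b\<bar> \<le> of_int N" for b
    proof -
      have "0 \<le> (\<bar>coord u b\<bar> - 1)\<^sup>2" by simp
      then have "2 * \<bar>coord u b\<bar> \<le> (coord u b)\<^sup>2 + 1" by (simp add: power2_diff)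
      then show ?thesis using sq[of b] by linarith
    qed
    then have bound: "coord u b \<le> of_int N" "- of_int N \<le> coord u b" for b
      by (auto simp: abs_le_iff) (metis minus_le_iff)
    let ?c = "\<lambda>b\<in>B. \<lfloor>coord u b\<rfloor>"
    have "?c \<in> PiE B (\<lambda>_. {-N..N})"
      using bound by (auto simp: le_floor_iff floor_le_iff) (smt (verit) bound)
    moreover have "u = (\<Sum>b\<in>B. of_int (?c b) *\<^sub>R b)"
    proof (rule coord_ext)
      fix b assume b: "b \<in> B"
      then obtain k where "coord u b = of_int k"
        using u by (auto simp: lattice_iff elim: Ints_cases)
      then show "coord u b = coord (\<Sum>b\<in>B. of_int (?c b) *\<^sub>R b) b"
        using b by (simp add: coord_of_sum)
    qed
    ultimately show "u \<in> (\<lambda>c. \<Sum>b\<in>B. of_int (c b) *\<^sub>R b) ` (PiE B (\<lambda>_. {-N..N}))"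
      by blast
  qed
  then show ?thesis
    by (rule finite_subset) (intro finite_imageI finite_PiE finite_B finite_atLeastAtMost_int)
qed

lemma covering_radius: "\<exists>R. \<forall>x. \<exists>u\<in>M'. q (x - u) \<le> R"
proof -
  have "0 \<in> unit_box" by (simp add: unit_box_def coord_simps)
  then obtain z where "\<And>x. x \<in> unit_box \<Longrightarrow> q x \<le> q z"
    using continuous_attains_sup[OF compact_unit_box _ continuous_on_subset[OF continuous_q]] by blast
  then show ?thesis using exists_lattice_unit_box by meson
qed

text \<open>A nonzero lattice vector has a nonzero integral coordinate, whose square is at least 1.
  The resulting bound \<open>1 / K\<close> is halved to make the inequality strict.\<close>

lemma lattice_separation: "\<exists>\<delta>>0. \<forall>u\<in>M'. u \<noteq> 0 \<longrightarrow> \<delta> < q u"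
proof -
  obtain K where K: "K > 0" "\<And>x b. (coord x b)\<^sup>2 \<le> K * q x"
    using coord_q_bound by blast
  have "1 / K \<le> q u" if u: "u \<in> M'" "u \<noteq> 0" for u
  proof -
    obtain b where b: "b \<in> B" "coord u b \<noteq> 0"
      using coord_ext[of u 0] u(2) coord_simps(4) by auto
    then obtain k where k: "coord u b = of_int k"
      using u(1) by (auto simp: lattice_iff elim: Ints_cases)
    with b have "1 \<le> k\<^sup>2" by (simp add: zero_less_power2 int_one_le_iff_zero_less)
    then have "1 \<le> (coord u b)\<^sup>2" unfolding k by (metis of_int_1_le_iff of_int_power)
    then have "1 \<le> K * q u" using K(2)[of u b] by linarith
    then show ?thesis using K(1) by (simp add: field_simps)
  qed
  moreover have "1 / (2 * K) < 1 / K" "0 < 1 / (2 * K)" using K(1) by (auto simp: field_simps)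
  ultimately show ?thesis by (meson less_le_trans)
qed

text \<open>Half of \<open>q\<close> has polarization \<open>Q\<close>, so it serves as the map
  \<open>\<gamma>\<close> belonging to \<open>l\<close>.\<close>

lemma tropical_descent_datum: "tropical_descent_datum pr M' l (\<lambda>u. q u / 2)"
  unfolding tropical_descent_datum_def
proof (intro conjI ballI)
  fix u v assume "u \<in> M'" "v \<in> M'"
  then show "q (u + v) / 2 - q u / 2 - q v / 2 = pr (l v) u"
    using Q_lattice[of v u] by (simp add: q_add sym_Q[of u v] add_divide_distrib)
qed (rule hom_l)

end

section \<open>Theta functions\<close>

text \<open>The centres \<open>a i\<close> need not be lattice points. \<open>Q_a\<close> requires
  each functional \<open>Q (a i)\<close> to come from \<open>M\<close>, which makes the slopes of
  the tangents integral.\<close>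

locale theta_data = polarized_lattice B M' pr Q l
  for B M' :: "'v::real_normed_vector set" and pr :: "'m::ab_group_add \<Rightarrow> 'v \<Rightarrow> real"
    and Q :: "'v \<Rightarrow> 'v \<Rightarrow> real" and l :: "'v \<Rightarrow> 'm" +
  fixes m :: nat and a :: "nat \<Rightarrow> 'v" and w :: "nat \<Rightarrow> 'm"
  assumes Q_a: "i \<le> m \<Longrightarrow> Q (a i) x = pr (w i) x"
begin

definition theta_slope :: "nat \<times> 'v \<Rightarrow> 'm" where
  "theta_slope j = - (w (fst j) + l (snd j))"

definition theta_const :: "nat \<times> 'v \<Rightarrow> real" where
  "theta_const j = q (a (fst j) + snd j) / 2"

text \<open>The pair \<open>(i, u)\<close> stands for the affine function tangent to \<open>- q / 2\<close> at \<open>a i + u\<close>.\<close>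

sublocale affine_family pr "{..m} \<times> M'" fst theta_slope theta_const
  by unfold_locales (simp_all add: linear_add[OF linear_pr] linear_scale[OF linear_pr]
      continuous_linear[OF linear_pr] pr_diff)

text \<open>Completing the square. Since \<open>- q x / 2\<close> is common to all indices,
  minimizing over \<open>u\<close> means finding the points of \<open>a i + M'\<close> nearest to
  \<open>x\<close>; the cells come from overlaying the Voronoi decompositions of these sets.\<close>

lemma aff_eq:
  assumes "i \<le> m" "u \<in> M'"
  shows "aff (i, u) x = (q (x - a i - u) - q x) / 2"
proof -
  have "aff (i, u) x = q (a i + u) / 2 - Q (a i + u) x"
    using assms by (simp add: aff_def theta_slope_def theta_const_def pr_minus pr_add pr_diff Q_a Q_lattice Q_simps)
  also have "\<dots> = (q (x - (a i + u)) - q x) / 2"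
    using q_diff[of x "a i + u"] sym_Q[of x "a i + u"] by simp
  finally show ?thesis by (simp add: diff_diff_eq)
qed

lemma active_iff:
  "(i, u) \<in> active x \<longleftrightarrow>
     i \<le> m \<and> u \<in> M' \<and> (\<forall>u'\<in>M'. q (x - a i - u) \<le> q (x - a i - u'))"
  by (auto simp: active_def aff_eq divide_le_cancel)

lemma active_translate: "(i, u) \<in> active x \<Longrightarrow> v \<in> M' \<Longrightarrow> (i, u + v) \<in> active (x + v)"
proof -
  assume *: "(i, u) \<in> active x" "v \<in> M'"
  have "q (x - a i - u) \<le> q (x + v - a i - u')" if "u' \<in> M'" for u'
  proof -
    have "q (x - a i - u) \<le> q (x - a i - (u' - v))"
      using * lattice_diff[OF that *(2)] by (simp add: active_iff)
    also have "x - a i - (u' - v) = x + v - a i - u'" by simp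
    finally show ?thesis .
  qed
  moreover have "x + v - a i - (u + v) = x - a i - u" by simp
  ultimately show ?thesis
    using * by (simp add: active_iff lattice_add)
qed

lemma exists_active:
  assumes "i \<le> m"
  shows "\<exists>u\<in>M'. (i, u) \<in> active x"
proof -
  let ?F = "{u \<in> M'. q (x - a i - u) \<le> q (x - a i)}"
  have "finite ?F" by (rule finite_lattice_ball)
  moreover have "0 \<in> ?F" by simp
  ultimately obtain u where u: "u \<in> ?F" "\<And>u'. u' \<in> ?F \<Longrightarrow> q (x - a i - u) \<le> q (x - a i - u')"
    using ex_is_arg_min_if_finite[of ?F "\<lambda>u. q (x - a i - u)"]
    unfolding is_arg_min_linorder by blast
  then have "q (x - a i - u) \<le> q (x - a i - u')" if "u' \<in> M'" for u'
    using that by (cases "u' \<in> ?F") auto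
  then show ?thesis using assms u(1) by (auto simp: active_iff)
qed

lemma finite_near:
  "finite {(i, u). i \<le> m \<and> u \<in> M' \<and> q (z - a i - u) \<le> r}"
proof -
  have "{(i, u). i \<le> m \<and> u \<in> M' \<and> q (z - a i - u) \<le> r} =
      Sigma {..m} (\<lambda>i. {u\<in>M'. q (z - a i - u) \<le> r})"
    by auto
  then show ?thesis by (simp add: finite_lattice_ball)
qed

lemma active_bounded: "\<exists>R. \<forall>i u x. (i, u) \<in> active x \<longrightarrow> q (x - a i - u) \<le> R"
proof -
  obtain R where R: "\<And>x. \<exists>u\<in>M'. q (x - u) \<le> R" using covering_radius by blast
  have "q (x - a i - u) \<le> R" if "(i, u) \<in> active x" for i u x
  proof -
    obtain u' where "u' \<in> M'" "q (x - a i - u') \<le> R" using R by blast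
    moreover from this have "q (x - a i - u) \<le> q (x - a i - u')"
      using that by (simp add: active_iff)
    ultimately show ?thesis by linarith
  qed
  then show ?thesis by blast
qed

text \<open>Active centres stay within the covering radius of the point, so a bounded region
  involves finitely many of them. A cell is bounded because a centre of group 0 that is active at
  its label stays active throughout the cell.\<close>

lemma locally_finite_family:
  "locally_finite_family pr ({..m} \<times> M') fst theta_slope theta_const"
proof
  obtain R where R: "\<And>i u x. (i, u) \<in> active x \<Longrightarrow> q (x - a i - u) \<le> R"
    using active_bounded by blast
  have near: "finite (\<Union>y\<in>S. active y)" if "\<And>y. y \<in> S \<Longrightarrow> q (y - z) \<le> r" for S z r
  proof (rule finite_subset[OF _ finite_near])
    show "(\<Union>y\<in>S. active y) \<subseteq> {(i, u). i \<le> m \<and> u \<in> M' \<and> q (z - a i - u) \<le> 2 * R + 2 * r}"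
    proof clarify
      fix i u y assume y: "y \<in> S" "(i, u) \<in> active y"
      have "q (z - a i - u) \<le> 2 * q (y - a i - u) + 2 * q (y - z)"
        using q_diff_le[of "y - a i - u" "y - z"] by (simp add: algebra_simps)
      then show "i \<le> m \<and> u \<in> M' \<and> q (z - a i - u) \<le> 2 * R + 2 * r"
        using R[OF y(2)] that[OF y(1)] y(2) by (auto simp: active_iff)
    qed
  qed
  show "\<exists>j'\<in>active x. fst j' = fst j" if j: "j \<in> {..m} \<times> M'" for j x
  proof -
    obtain u where "(fst j, u) \<in> active x" using j exists_active[of "fst j" x] by auto
    then show ?thesis by (metis fst_conv)
  qed
  show "\<exists>U. open U \<and> x \<in> U \<and> finite (\<Union>y\<in>U. active y)" for x
  proof (intro exI conjI)
    have "continuous_on UNIV (\<lambda>y. q (y - x))"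
      by (rule continuous_on_compose2[OF continuous_q]) (auto intro: continuous_intros)
    then show "open {y. q (y - x) < 1}"
      by (intro open_Collect_less continuous_on_const)
    show "finite (\<Union>y\<in>{y. q (y - x) < 1}. active y)" by (rule near[of _ x 1]) simp
  qed simp
  show "finite (\<Union>y\<in>cell x. active y)" for x
  proof -
    obtain u where u: "(0, u) \<in> active x" using exists_active[of 0] by blast
    then have "(0, u) \<in> active y" if "y \<in> cell x" for y
      using that by (auto simp: cell_def)
    then show ?thesis
      using R by (intro near[of _ "a 0 + u" R]) (simp add: diff_diff_eq)
  qed
qed

sublocale locally_finite_family pr "{..m} \<times> M'" fst theta_slope theta_const
  by (rule locally_finite_family)

definition theta :: "nat \<Rightarrow> 'v \<Rightarrow> real" where
  "theta i x = Inf ((\<lambda>u. aff (i, u) x) ` M')"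

lemma theta_eq: "(i, u) \<in> active x \<Longrightarrow> theta i x = aff (i, u) x"
  unfolding theta_def by (rule cInf_eq_minimum) (auto simp: active_iff aff_eq divide_le_cancel)

lemma theta_le:
  assumes "i \<le> m" "u \<in> M'"
  shows "theta i x \<le> aff (i, u) x"
proof -
  obtain v where v: "(i, v) \<in> active x" using exists_active[OF assms(1)] by blast
  then show ?thesis
    using assms activeD[OF v, of "(i, u)"] by (simp add: theta_eq)
qed

lemma concave_theta:
  assumes "i \<le> m"
  shows "concave_on UNIV (theta i)"
  unfolding concave_on_iff
proof (intro conjI ballI allI impI)
  fix x y :: 'v and s t :: real
  assume st: "0 \<le> s" "0 \<le> t" "s + t = 1"
  obtain u where u: "u \<in> M'" "(i, u) \<in> active (s *\<^sub>R x + t *\<^sub>R y)"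
    using exists_active[OF assms] by blast
  have s: "s = 1 - t" using st by simp
  have "s * theta i x + t * theta i y \<le> s * aff (i, u) x + t * aff (i, u) y"
    using st theta_le[OF assms u(1)] by (intro add_mono mult_left_mono) auto
  also have "\<dots> = aff (i, u) (s *\<^sub>R x + t *\<^sub>R y)" unfolding s by (rule aff_segment[symmetric])
  finally show "s * theta i x + t * theta i y \<le> theta i (s *\<^sub>R x + t *\<^sub>R y)"
    by (simp add: theta_eq[OF u(2)])
qed simp

text \<open>Translation by \<open>v\<close> carries nearest centres to nearest centres at the same
  distance, so only the summand \<open>- q / 2\<close> changes.\<close>

lemma theta_translate:
  assumes "i \<le> m" "v \<in> M'"
  shows "theta i (x + v) = theta i x - pr (l v) x - q v / 2"
proof -
  obtain u where u: "u \<in> M'" "(i, u) \<in> active x"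
    using exists_active[OF assms(1)] by blast
  have "aff (i, u + v) (x + v) = aff (i, u) x - Q v x - q v / 2"
  proof -
    have "x + v - a i - (u + v) = x - a i - u" by simp
    then have "aff (i, u + v) (x + v) = (q (x - a i - u) - q (x + v)) / 2"
      using aff_eq[OF assms(1) lattice_add[OF u(1) assms(2)], of "x + v"] by simp
    then show ?thesis
      using aff_eq[OF assms(1) u(1), of x] q_add[of x v] sym_Q[of x v] by (simp add: field_simps)
  qed
  then show ?thesis
    using theta_eq[OF u(2)] theta_eq[OF active_translate[OF u(2) assms(2)]] assms(2)
    by (simp add: Q_lattice)
qed

lemma theta_on_cell:
  "(i, u) \<in> active x \<Longrightarrow> y \<in> cell x \<Longrightarrow> theta i y = pr (- (w i + l u)) y + q (a i + u) / 2"
  using theta_eq[of i u y] by (auto simp: cell_def aff_def theta_slope_def theta_const_def)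

lemma finite_sections_theta:
  "finite_sections pr M' l (\<lambda>u. q u / 2) m (\<lambda>i x. ereal (theta i x))"
proof -
  have "piecewise_Z_affine pr (theta i)" if i: "i \<le> m" for i
    unfolding piecewise_Z_affine_def
  proof (intro exI[of _ "range cell"] conjI ballI)
    show "rational_polyhedral_decomposition pr (range cell)"
      by (rule rational_polyhedral_decomposition_cells)
    fix C assume "C \<in> range cell"
    then obtain x where x: "C = cell x" by blast
    obtain u where "(i, u) \<in> active x" using exists_active[OF i] by blast
    then show "\<exists>u b. \<forall>x\<in>C. theta i x = pr u x + b"
      using theta_on_cell[of i _ x] unfolding x by blast
  qed
  then have "regular_function pr (\<lambda>x. ereal (theta i x))" if "i \<le> m" for i
    using that concave_theta unfolding regular_function_def by blast
  moreover have "(\<lambda>x::'v. ereal (theta i x)) \<noteq> (\<lambda>_. \<infinity>)" for i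
    using fun_cong[of "\<lambda>x::'v. ereal (theta i x)" "\<lambda>_. \<infinity>" 0] by auto
  ultimately show ?thesis
    by (auto simp: finite_sections_def H0_def theta_translate)
qed

lemma continuous_theta:
  assumes i: "i \<le> m"
  shows "continuous_on UNIV (theta i)"
proof -
  have "(theta i \<longlongrightarrow> theta i x) (at x)" for x
  proof (rule tendstoI)
    fix e :: real assume "e > 0"
    obtain V where V: "open V" "x \<in> V" "\<And>y. y \<in> V \<Longrightarrow> active y \<subseteq> active x"
      using active_upper_semicontinuous[of x] by blast
    have "\<forall>\<^sub>F y in at x. dist (aff j y) (aff j x) < e" for j
      using continuous_aff[of j] \<open>e > 0\<close>
      by (intro tendstoD) (auto simp: continuous_on_def)
    then have "\<forall>\<^sub>F y in at x. \<forall>j\<in>active x. dist (aff j y) (aff j x) < e"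
      by (intro eventually_ball_finite finite_active) blast
    moreover have "\<forall>\<^sub>F y in at x. y \<in> V"
      using V(1,2) by (rule eventually_at_in_open')
    ultimately show "\<forall>\<^sub>F y in at x. dist (theta i y) (theta i x) < e"
    proof eventually_elim
      fix y assume y: "\<forall>j\<in>active x. dist (aff j y) (aff j x) < e" "y \<in> V"
      obtain u where u: "(i, u) \<in> active y" using exists_active[OF i] by blast
      then have "(i, u) \<in> active x" using V(3)[OF y(2)] by blast
      then show "dist (theta i y) (theta i x) < e"
        using y(1) u by (simp add: theta_eq)
    qed
  qed
  then show ?thesis by (simp add: continuous_on_def)
qed

end

section \<open>Faithful embeddings from fine sets of theta functions\<close>

text \<open>\<open>E\<close> is meant to hold small vectors representing generators of
  \<open>M\<close>. \<open>generating\<close> expresses this by divisibility of values: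
  \<open>t = 0\<close> yields injectivity of linear parts, integral \<open>t\<close> yields
  torsion-free cokernels. \<open>dense\<close> places a whole translate \<open>p + E\<close> among
  the centres near \<open>x\<close>, and \<open>separated\<close> keeps the lattice translates of
  one centre apart at that scale.\<close>

locale fine_theta_data = theta_data B M' pr Q l m a w
  for B M' :: "'v::real_normed_vector set" and pr :: "'m::ab_group_add \<Rightarrow> 'v \<Rightarrow> real"
    and Q :: "'v \<Rightarrow> 'v \<Rightarrow> real" and l :: "'v \<Rightarrow> 'm"
    and m :: nat and a :: "nat \<Rightarrow> 'v" and w :: "nat \<Rightarrow> 'm" +
  fixes E :: "'v set" and \<rho> :: real
  assumes zero_E: "0 \<in> E"
    and dense: "\<exists>p. \<forall>e\<in>E. \<exists>i\<le>m. \<exists>u\<in>M'. a i + u = p + e \<and> q (x - (p + e)) \<le> \<rho>"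
    and separated: "u \<in> M' \<Longrightarrow> u \<noteq> 0 \<Longrightarrow> 40 * \<rho> < q u"
    and generating:
      "(\<And>e. e \<in> E \<Longrightarrow> \<exists>k. Q e x = t * of_int k) \<Longrightarrow> \<exists>k. pr v x = t * of_int k"
begin

lemma rho_nonneg: "0 \<le> \<rho>"
  using dense[of 0] zero_E q_nonneg by (meson order.trans)

lemma eq_0I:
  assumes "\<And>e. e \<in> E \<Longrightarrow> Q e x = 0"
  shows "x = 0"
proof (rule point_eqI)
  fix v
  show "pr v x = pr v 0"
    using generating[of x 0 v] assms by (simp add: linear_0[OF linear_pr])
qed

text \<open>The constant 40 is \<open>2 * 10 + 2 * 10\<close>: two different lattice vectors this
  close to \<open>x - a i\<close> would differ by a vector shorter than \<open>separated\<close>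
  permits.\<close>

lemma active_unique:
  assumes "(i, u) \<in> active x" "v \<in> M'" "q (x - a i - v) \<le> 10 * \<rho>"
  shows "u = v"
proof (rule ccontr)
  assume "u \<noteq> v"
  have u: "u \<in> M'" "q (x - a i - u) \<le> q (x - a i - v)"
    using assms by (auto simp: active_iff)
  have "q (u - v) \<le> 2 * q (x - a i - v) + 2 * q (x - a i - u)"
    using q_diff_le[of "x - a i - v" "x - a i - u"] by simp
  moreover have "40 * \<rho> < q (u - v)"
    using separated[OF lattice_diff[OF u(1) assms(2)]] \<open>u \<noteq> v\<close> by simp
  ultimately show False using u(2) assms(3) by linarith
qed

lemma activeI:
  assumes "i \<le> m" "v \<in> M'" "q (x - a i - v) \<le> 10 * \<rho>"
  shows "(i, v) \<in> active x"
  using exists_active[OF assms(1), of x] active_unique[OF _ assms(2,3)] by blast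

lemma theta_active: "(i, u) \<in> active x \<Longrightarrow> 2 * theta i x + q x = q (x - a i - u)"
  using theta_eq[of i u x] aff_eq[of i u x] by (simp add: active_iff)

text \<open>Equal theta values force the lattice distances of \<open>x\<close> and \<open>y\<close> to all \<open>a i\<close> to differ by a
  constant \<open>c\<close>.  A point \<open>p\<close> close to \<open>x\<close> is then close to a translate \<open>z\<close> of \<open>y\<close>, and comparing the
  distances to \<open>p\<close> and to \<open>p + e\<close> shows that \<open>x - z\<close> is orthogonal to \<open>e\<close>.\<close>

lemma theta_separates_aux:
  assumes eq: "\<And>i. i \<le> m \<Longrightarrow> (2 * theta i x + q x) - (2 * theta i y + q y) = c"
    and "0 \<le> c"
  shows "x - y \<in> M'"
proof -
  obtain p where p: "\<And>e. e \<in> E \<Longrightarrow> \<exists>i\<le>m. \<exists>u\<in>M'. a i + u = p + e \<and> q (x - (p + e)) \<le> \<rho>"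
    using dense[of x] by blast
  have near: "q (x - p) \<le> \<rho>" using p[OF zero_E] by auto
  obtain i0 u0 where i0: "i0 \<le> m" "u0 \<in> M'" "a i0 + u0 = p"
    using p[OF zero_E] by auto
  have diff_p: "x' - a i0 - u0 = x' - p" for x'
    using i0(3) by (simp add: diff_diff_eq)
  have "(i0, u0) \<in> active x"
    using near rho_nonneg by (intro activeI i0) (simp add: diff_p)
  then have x0: "2 * theta i0 x + q x = q (x - p)"
    using theta_active[of i0 u0 x] by (simp add: diff_p)
  obtain v where v: "v \<in> M'" "(i0, v) \<in> active y" using exists_active[OF i0(1)] by blast
  \<comment> \<open>The translate of \<open>y\<close> for which \<open>p\<close> is a nearest centre
    in the group of \<open>i0\<close>.\<close>
  define z where "z = y - (v - u0)"
  have "y - a i0 - v = z - a i0 - u0" by (simp add: z_def)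
  then have y0: "2 * theta i0 y + q y = q (z - p)"
    using theta_active[OF v(2)] by (simp add: diff_p)
  \<comment> \<open>The sign of \<open>c\<close> enters here: \<open>z\<close> is at least as close
    to \<open>p\<close> as \<open>x\<close> is.\<close>
  have c: "q (x - p) - q (z - p) = c" using eq[OF i0(1)] x0 y0 by simp
  then have zp: "q (z - p) \<le> \<rho>" using near \<open>0 \<le> c\<close> by linarith
  have "x - z = 0"
  proof (rule eq_0I)
    fix e assume e: "e \<in> E"
    obtain i u where i: "i \<le> m" "u \<in> M'" "a i + u = p + e" "q (x - (p + e)) \<le> \<rho>"
      using p[OF e] by blast
    have diff_pe: "x' - a i - u = x' - (p + e)" for x'
      using i(3) by (simp add: diff_diff_eq)
    have "(i, u) \<in> active x"
      using i(4) rho_nonneg by (intro activeI i) (simp add: diff_pe)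
    then have xi: "2 * theta i x + q x = q (x - (p + e))"
      using theta_active[of i u x] by (simp add: diff_pe)
    \<comment> \<open>Origin of the factor 10: \<open>q_diff_le\<close> gives
      \<open>q e \<le> 4 * \<rho>\<close>, and a second use bounds \<open>q (z - (p + e))\<close> by
      \<open>2 * \<rho> + 8 * \<rho>\<close>.\<close>
    have "q e \<le> 2 * q (x - p) + 2 * q (x - (p + e))"
      using q_diff_le[of "x - p" "x - (p + e)"] by simp
    then have "q e \<le> 4 * \<rho>" using near i(4) by linarith
    moreover have "q (z - (p + e)) \<le> 2 * q (z - p) + 2 * q e"
      using q_diff_le[of "z - p" e] by (simp add: diff_diff_eq)
    ultimately have ze: "q (z - (p + e)) \<le> 10 * \<rho>" using zp by linarith
    have ye: "y - a i - (u + (v - u0)) = z - (p + e)"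
      using i(3) by (simp add: z_def algebra_simps)
    have "(i, u + (v - u0)) \<in> active y"
      by (intro activeI i(1) lattice_add lattice_diff i(2) v(1) i0(2)) (simp only: ye ze)
    then have yi: "2 * theta i y + q y = q (z - (p + e))"
      using theta_active[of i _ y] by (simp only: ye)
    have "q (x - p - e) - q (z - p - e) = q (x - p) - q (z - p)"
      using eq[OF i(1)] xi yi c by (simp add: diff_diff_eq)
    then have "Q (x - p) e = Q (z - p) e"
      using q_diff[of "x - p" e] q_diff[of "z - p" e] by simp
    then show "Q e (x - z) = 0"
      by (simp add: sym_Q[of e] Q_simps)
  qed
  then have "x - y = - (v - u0)" by (simp add: z_def algebra_simps)
  then show ?thesis using lattice_minus[OF lattice_diff[OF v(1) i0(2)]] by simp
qed

lemma theta_separates: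
  assumes "\<And>i. i \<le> m \<Longrightarrow> theta i x - theta 0 x = theta i y - theta 0 y"
  shows "x - y \<in> M'"
proof -
  let ?c = "(2 * theta 0 x + q x) - (2 * theta 0 y + q y)"
  have *: "(2 * theta i x + q x) - (2 * theta i y + q y) = ?c" if "i \<le> m" for i
    using assms[OF that] by simp
  show ?thesis
  proof (cases "0 \<le> ?c")
    case True
    show ?thesis by (rule theta_separates_aux[OF * True])
  next
    case False
    have "(2 * theta i y + q y) - (2 * theta i x + q x) = - ?c" if "i \<le> m" for i
      using *[OF that] by linarith
    moreover have "0 \<le> - ?c" using False by linarith
    ultimately have "y - x \<in> M'" by (rule theta_separates_aux)
    then show ?thesis using lattice_minus[of "y - x"] by simp
  qed
qed

section \<open>The map given by theta functions is a unimodular embedding\<close>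

definition theta_map :: "'v set \<Rightarrow> nat \<Rightarrow> real" where
  "theta_map = torus_map m (\<lambda>i x. ereal (theta i x))"

lemma theta_map_torus_proj:
  "theta_map (torus_proj M' x) = (\<lambda>i. if i < m then theta (Suc i) x - theta 0 x else 0)"
  using torus_map_torus_proj[OF full_lattice finite_sections_theta, of x]
  by (simp add: theta_map_def proj_coords_def)

lemma inj_on_theta_map: "inj_on theta_map (torus M')"
proof (rule inj_onI)
  fix X Y assume XY: "X \<in> torus M'" "Y \<in> torus M'" "theta_map X = theta_map Y"
  obtain x y where xy: "X = torus_proj M' x" "Y = torus_proj M' y"
    using XY(1,2) by (auto simp: torus_def)
  have eq: "(if j < m then theta (Suc j) x - theta 0 x else 0) =
      (if j < m then theta (Suc j) y - theta 0 y else 0)" for j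
    using XY(3) unfolding xy theta_map_torus_proj by (rule fun_cong)
  have "theta i x - theta 0 x = theta i y - theta 0 y" if "i \<le> m" for i
    using eq[of "i - 1"] that by (cases i) auto
  then have "x - y \<in> M'" by (rule theta_separates)
  then show "X = Y" by (simp add: xy torus_proj_eq_iff)
qed

text \<open>The torus is compact, being the image of the unit box, so a continuous injection into a
  Hausdorff space is closed and therefore an embedding.\<close>

lemma embedding_map_theta_map: "embedding_map (torus_topology M') (Euclidean_space m) theta_map"
proof (rule injective_closed_imp_embedding_map)
  have "theta_map \<circ> torus_proj M' = (\<lambda>x i. if i < m then theta (Suc i) x - theta 0 x else 0)"
    by (rule ext) (simp only: o_apply theta_map_torus_proj)
  moreover have "continuous_map euclidean (Euclidean_space m)
      (\<lambda>x i. if i < m then theta (Suc i) x - theta 0 x else 0)"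
    unfolding continuous_map_componentwise_Euclidean_space
    by (auto intro!: continuous_on_diff continuous_theta)
  ultimately have cont: "continuous_map (torus_topology M') (Euclidean_space m) theta_map"
    by (intro continuous_compose_quotient_map[OF quotient_map_torus_proj]) simp
  have "torus M' = torus_proj M' ` unit_box"
  proof -
    have "torus_proj M' x \<in> torus_proj M' ` unit_box" for x
    proof -
      obtain u where "u \<in> M'" "x - u \<in> unit_box" using exists_lattice_unit_box by blast
      moreover from this have "torus_proj M' x = torus_proj M' (x - u)"
        by (simp add: torus_proj_eq_iff)
      ultimately show ?thesis by blast
    qed
    then show ?thesis unfolding torus_def by blast
  qed
  moreover have "compactin (torus_topology M') (torus_proj M' ` unit_box)"
    by (rule image_compactin[OF _ quotient_imp_continuous_map[OF quotient_map_torus_proj]])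
      (simp add: compact_unit_box)
  ultimately have "compact_space (torus_topology M')"
    by (simp add: compact_space_def topspace_torus_topology)
  then show "closed_map (torus_topology M') (Euclidean_space m) theta_map"
    using cont by (intro continuous_imp_closed_map Hausdorff_Euclidean_space)
  show "continuous_map (torus_topology M') (Euclidean_space m) theta_map" by (rule cont)
  show "inj_on theta_map (topspace (torus_topology M'))"
    by (simp add: topspace_torus_topology inj_on_theta_map)
qed

lemma unimodular_theta_map: "unimodular pr M' m theta_map"
  unfolding unimodular_def
proof (intro exI[of _ "range cell"] conjI ballI)
  show "rational_polyhedral_decomposition pr (range cell)"
    by (rule rational_polyhedral_decomposition_cells)
  fix C assume "C \<in> range cell"
  then obtain x where C: "C = cell x" by blast
  have "\<exists>u. \<forall>i\<in>{..m}. u i \<in> M' \<and> (i, u i) \<in> active x"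
    by (rule bchoice) (use exists_active in blast)
  then obtain u where u: "\<And>i. i \<le> m \<Longrightarrow> (i, u i) \<in> active x" "\<And>i. i \<le> m \<Longrightarrow> u i \<in> M'"
    by auto
  define P where "P i = a i + u i" for i
  have pr_P: "pr (w i + l (u i)) y = Q (P i) y" if "i \<le> m" for i y
    using that u by (simp add: P_def pr_add Q_simps Q_a Q_lattice)
  have theta_P: "theta i y = q (P i) / 2 - Q (P i) y" if "y \<in> cell x" "i \<le> m" for i y
    using theta_on_cell[OF u(1) that(1)] pr_P that(2) by (simp only: P_def pr_minus)
  \<comment> \<open>The linear part on the cell. Tangents have slope \<open>- Q (P i)\<close>, so
    subtracting the reference function \<open>theta 0\<close> from \<open>theta (Suc i)\<close>
    leaves \<open>P 0 - P (Suc i)\<close>.\<close>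
  define A where "A y = (\<lambda>i. if i < m then Q (P 0 - P (Suc i)) y else 0)" for y
  define b where "b = (\<lambda>i. if i < m then q (P (Suc i)) / 2 - q (P 0) / 2 else 0)"
  have A_integral: "A y i \<in> \<int>" if "y \<in> integral_points pr" for y i
    using that pr_P[of 0 y] pr_P[of "Suc i" y]
    by (auto simp: A_def integral_points_def Q_simps) (metis Ints_diff Suc_leI)
  obtain p where p: "\<And>e. e \<in> E \<Longrightarrow> \<exists>i\<le>m. \<exists>u\<in>M'. a i + u = p + e \<and> q (x - (p + e)) \<le> \<rho>"
    using dense[of x] by blast
  \<comment> \<open>Uniqueness of the nearest centre at \<open>x\<close> forces all centres
    \<open>p + e\<close> to be among the selected points \<open>P i\<close>.\<close>
  have E_P: "\<exists>i\<le>m. P i = p + e" if e: "e \<in> E" for e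
  proof -
    obtain i v where i: "i \<le> m" "v \<in> M'" "a i + v = p + e" "q (x - (p + e)) \<le> \<rho>"
      using p[OF e] by blast
    have "q (x - a i - v) = q (x - (p + e))" using i(3) by (simp add: diff_diff_eq)
    then have "q (x - a i - v) \<le> 10 * \<rho>" using i(4) rho_nonneg by linarith
    then have "u i = v" by (rule active_unique[OF u(1)[OF i(1)] i(2)])
    then show ?thesis using i by (auto simp: P_def)
  qed
  \<comment> \<open>Each \<open>e\<close> is a difference \<open>P i - P i0\<close> with
    \<open>P i0 = p\<close>, which exists because \<open>0 \<in> E\<close>. Divisibility of the
    coordinates of \<open>A y\<close> by \<open>t\<close> therefore passes to all
    \<open>Q e y\<close>, and by \<open>generating\<close> to all of \<open>M\<close>.\<close>
  have generate: "\<exists>k. pr v y = t * of_int k" if "\<And>i. \<exists>k. A y i = t * of_int k" for t y v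
  proof (rule generating)
    have P0: "\<exists>k. Q (P 0 - P i) y = t * of_int k" if "i \<le> m" for i
    proof (cases i)
      case 0
      then show ?thesis by (intro exI[of _ 0]) (simp add: Q_simps)
    next
      case (Suc j)
      then show ?thesis using \<open>\<And>i. \<exists>k. A y i = t * of_int k\<close>[of j] that by (simp add: A_def)
    qed
    fix e assume "e \<in> E"
    then obtain i where i: "i \<le> m" "P i = p + e" using E_P by blast
    obtain i0 where i0: "i0 \<le> m" "P i0 = p" using E_P[OF zero_E] by auto
    obtain k k0 where "Q (P 0 - P i) y = t * of_int k" "Q (P 0 - P i0) y = t * of_int k0"
      using P0 i(1) i0(1) by blast
    then have "Q e y = t * of_int (k0 - k)"
      by (simp add: i i0 Q_simps algebra_simps)
    then show "\<exists>k. Q e y = t * of_int k" by blast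
  qed
  have "unimodular_linear_map pr m A"
    unfolding unimodular_linear_map_def
  proof (intro conjI allI ballI impI)
    show "range A \<subseteq> topspace (Euclidean_space m)"
      by (auto simp: topspace_Euclidean_space A_def)
    show "linear (\<lambda>x. A x i)" for i
      by (cases "i < m") (simp_all add: A_def linear_Q linear_zero)
    show "A ` integral_points pr \<subseteq> integer_points m"
      using A_integral by (auto simp: integer_points_def topspace_Euclidean_space) (simp add: A_def)
    show "inj_on A (integral_points pr)"
    proof (rule inj_onI)
      fix y z assume "A y = A z"
      \<comment> \<open>The shape in which \<open>generate\<close> applies with
        \<open>t = 0\<close>.\<close>
      then have "A (y - z) i = 0 * of_int 0" for i
        by (auto simp: A_def Q_simps dest: fun_cong[of _ _ i])
      then have "pr v (y - z) = 0" for v using generate[of "y - z" 0 v] by fastforce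
      then show "y = z"
        by (intro point_eqI) (simp add: linear_diff[OF linear_pr])
    qed
    fix y and k :: int
    assume y: "y \<in> integer_points m" and k: "k \<noteq> 0 \<and> (\<lambda>i. of_int k * y i) \<in> A ` integral_points pr"
    then obtain z where z: "z \<in> integral_points pr" "\<And>i. A z i = of_int k * y i"
      by (metis (no_types, lifting) imageE)
    have "\<exists>j. A z i = of_int k * of_int j" for i
      using y z(2)[of i] by (auto simp: integer_points_def elim: Ints_cases)
    then have "\<exists>j. pr v z = of_int k * of_int j" for v by (rule generate)
    then have "pr v ((1 / of_int k) *\<^sub>R z) \<in> \<int>" for v
    proof -
      obtain j where "pr v z = of_int k * of_int j"
        using \<open>\<And>v. \<exists>j. pr v z = of_int k * of_int j\<close> by blast
      then have "pr v ((1 / of_int k) *\<^sub>R z) = of_int j"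
        using k by (simp add: linear_scale[OF linear_pr])
      then show ?thesis by simp
    qed
    moreover have "A ((1 / of_int k) *\<^sub>R z) = y"
    proof
      fix i
      have "A ((1 / of_int k) *\<^sub>R z) i = (1 / of_int k) * A z i"
        by (simp add: A_def Q_simps)
      then show "A ((1 / of_int k) *\<^sub>R z) i = y i" using z(2) k by simp
    qed
    ultimately show "y \<in> A ` integral_points pr"
      by (auto simp: integral_points_def intro!: image_eqI[of _ _ "(1 / of_int k) *\<^sub>R z"])
  qed
  moreover have "b \<in> topspace (Euclidean_space m)"
    by (auto simp: b_def topspace_Euclidean_space)
  moreover have "theta_map (torus_proj M' y) = (\<lambda>i. A y i + b i)" if "y \<in> C" for y
    using that theta_P unfolding C theta_map_torus_proj
    by (auto simp: A_def b_def Q_simps)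
  ultimately show "\<exists>A b. unimodular_linear_map pr m A \<and> b \<in> topspace (Euclidean_space m) \<and>
      (\<forall>x\<in>C. theta_map (torus_proj M' x) = (\<lambda>i. A x i + b i))"
    by blast
qed

lemma admits_faithful_embedding: "admits_faithful_embedding pr M' l (\<lambda>u. q u / 2)"
  unfolding admits_faithful_embedding_def faithful_embedding_def
  using finite_sections_theta unimodular_theta_map embedding_map_theta_map
  unfolding theta_map_def by blast

end

section \<open>Fine centres for a multiple of a polarization\<close>

lemma full_lattice_basis:
  assumes "full_lattice M'"
  obtains B where "lattice_basis B M'"
proof -
  obtain B where "finite B" "independent B" "span B = UNIV"
    "M' = {(\<Sum>b\<in>B. of_int (c b) *\<^sub>R b) | c :: 'a \<Rightarrow> int. True}"
    using assms unfolding full_lattice_def by auto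
  then show ?thesis by (intro that[of B] lattice_basis.intro)
qed

lemma (in lattice_basis) bilinear_symI:
  fixes Q :: "'v \<Rightarrow> 'v \<Rightarrow> real"
  assumes Q: "bilinear Q" and sym: "\<And>b b'. b \<in> B \<Longrightarrow> b' \<in> B \<Longrightarrow> Q b b' = Q b' b"
  shows "Q x y = Q y x"
proof -
  have lin: "linear (Q z)" "linear (\<lambda>y. Q y z)" for z
    using Q by (simp_all add: bilinear_def)
  have "Q b y = Q y b" if "b \<in> B" for b y
    by (rule linear_ext[OF lin(1)[of b] lin(2)[of b]]) (rule sym[OF that])
  then show ?thesis by (rule linear_ext[OF lin(2)[of y] lin(1)[of y]])
qed

lemma polarized_latticeI:
  assumes "lattice_basis B M'" "is_real_dual pr" "hom_on M' l" "bilinear Q"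
    and sym: "\<And>u v. u \<in> M' \<Longrightarrow> v \<in> M' \<Longrightarrow> pr (l u) v = pr (l v) u"
    and Q: "\<And>u v. u \<in> M' \<Longrightarrow> v \<in> M' \<Longrightarrow> Q u v = pr (l u) v"
    and pos: "\<And>x. x \<noteq> 0 \<Longrightarrow> (Q x x :: real) > 0"
  shows "polarized_lattice B M' pr Q l"
proof -
  interpret lattice_basis B M' by fact
  interpret real_dual pr by unfold_locales fact
  show ?thesis
  proof
    show "Q x y = Q y x" for x y
      by (rule bilinear_symI[OF assms(4)]) (simp add: Q sym lattice_basis)
    show "Q u x = pr (l u) x" if "u \<in> M'" for u x
    proof (rule linear_ext[of "Q u" "pr (l u)"])
      show "linear (Q u)" using assms(4) by (simp add: bilinear_def)
      show "Q u b = pr (l u) b" if "b \<in> B" for b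
        using Q[OF \<open>u \<in> M'\<close> lattice_basis[OF that]] .
    qed (rule linear_pr)
  qed (rule assms, rule assms, rule pos)
qed

context polarized_lattice
begin

text \<open>\<open>\<Phi>\<close> records the functional \<open>Q x\<close> by its values on the
  basis; positivity makes it injective, hence surjective in finite dimension.\<close>

lemma representable:
  fixes g :: "'v \<Rightarrow> real"
  assumes g: "linear g"
  obtains e where "\<And>x. Q e x = g x"
proof -
  interpret fd: finite_dimensional_vector_space "scaleR :: real \<Rightarrow> 'v \<Rightarrow> 'v" B
    using finite_B independent_B span_B
    by unfold_locales (simp_all add: dependent_raw_def span_raw_def)
  define \<Phi> where "\<Phi> x = (\<Sum>b\<in>B. Q x b *\<^sub>R b)" for x
  have lin: "linear \<Phi>"
    unfolding \<Phi>_def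
    by (intro linearI) (simp_all add: Q_simps scaleR_add_left sum.distrib scaleR_sum_right)
  have coord_\<Phi>: "Q x b = coord (\<Phi> x) b" if "b \<in> B" for x b
    using that by (simp add: \<Phi>_def coord_of_sum)
  have "inj \<Phi>"
  proof (subst linear_injective_0[OF lin], intro allI impI)
    fix x assume "\<Phi> x = 0"
    then have "Q x b = 0" if "b \<in> B" for b
      using coord_\<Phi>[OF that, of x] by (simp add: coord_simps)
    then have "Q x x = 0"
      by (rule linear_ext[OF linear_Q linear_zero])
    then show "x = 0" using pos_Q[of x] by (cases "x = 0") simp_all
  qed
  then have "surj \<Phi>"
    using lin unfolding linear_def by (intro fd.linear_inj_imp_surj)
  then obtain e where "(\<Sum>b\<in>B. g b *\<^sub>R b) = \<Phi> e" by (rule surjE)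
  then have e: "\<Phi> e = (\<Sum>b\<in>B. g b *\<^sub>R b)" by simp
  have "Q e x = g x" for x
  proof (rule linear_ext[OF linear_Q g])
    fix b assume "b \<in> B"
    then show "Q e b = g b" using e coord_\<Phi>[of b e] by (simp add: coord_of_sum)
  qed
  then show ?thesis by (rule that)
qed

lemma scaled:
  assumes "module zscale" "k > 0"
  shows "polarized_lattice B M' pr (\<lambda>x y. of_int k * Q x y) (\<lambda>u. zscale k (l u))"
proof
  interpret module zscale by fact
  show "hom_on M' (\<lambda>u. zscale k (l u))"
    using hom_l by (auto simp: hom_on_def scale_right_distrib)
  show "bilinear (\<lambda>x y. of_int k * Q x y)"
    unfolding bilinear_def
    by (intro conjI allI linearI) (simp_all add: Q_simps algebra_simps)
  show "of_int k * Q x y = of_int k * Q y x" for x y using sym_Q[of x y] by simp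
  show "0 < of_int k * Q x x" if "x \<noteq> 0" for x using pos_Q[OF that] assms(2) by simp
  show "of_int k * Q u x = pr (zscale k (l u)) x" if "u \<in> M'" for u x
    using that by (simp add: Q_lattice pr_zscale[OF assms(1)])
qed

text \<open>Scaling the form by \<open>k\<close> makes both \<open>M' / k\<close> and the vectors \<open>e / k\<close> representing the basis of
  \<open>M\<close> admissible centres; measured in the scaled form, their distances shrink like \<open>1 / k\<close> while
  the minimum of \<open>M'\<close> grows like \<open>k\<close>.\<close>

lemma exists_faithful_embedding:
  fixes zscale :: "int \<Rightarrow> 'm \<Rightarrow> 'm"
  assumes "free_Z_module_of_rank zscale n"
  shows "\<exists>l \<gamma>. tropical_descent_datum pr M' l \<gamma> \<and> admits_faithful_embedding pr M' l \<gamma>"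
proof -
  interpret module zscale
    using assms by (simp add: free_Z_module_of_rank_def)
  have module: "module zscale" by (rule module_axioms)
  obtain BM where BM: "finite BM" "span BM = UNIV"
    using assms by (auto simp: free_Z_module_of_rank_def)
  have "\<forall>v. \<exists>e. \<forall>x. Q e x = pr v x"
    using representable[OF linear_pr] by metis
  then obtain r where r: "\<And>v x. Q (r v) x = pr v x" by metis
  define E0 where "E0 = insert 0 (r ` BM)"
  have "finite E0" using BM by (simp add: E0_def)
  have E0_pr: "\<exists>v. \<forall>x. Q e x = pr v x" if "e \<in> E0" for e
    using that r by (auto simp: E0_def Q_simps intro: exI[of _ 0] simp: pr_0)
  obtain R where R: "\<And>x. \<exists>u\<in>M'. q (x - u) \<le> R" using covering_radius by blast
  then have "0 \<le> R" using q_nonneg by (meson order.trans)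
  define S where "S = (\<Sum>e\<in>E0. q e)"
  have S: "q e \<le> S" if "e \<in> E0" for e
    unfolding S_def using \<open>finite E0\<close> that q_nonneg by (intro member_le_sum) auto
  have "0 \<le> S" unfolding S_def by (intro sum_nonneg q_nonneg)
  obtain \<delta> where \<delta>: "\<delta> > 0" "\<And>u. u \<in> M' \<Longrightarrow> u \<noteq> 0 \<Longrightarrow> \<delta> < q u"
    using lattice_separation by blast
  \<comment> \<open>Chosen so that \<open>40 * \<rho> \<le> \<kappa> * \<delta>\<close> for the
    \<open>\<rho>\<close> below, that is \<open>80 * (R + S) \<le> k\<^sup>2 * \<delta>\<close>; the
    lower bound 1 gives \<open>k \<le> k\<^sup>2\<close>.\<close>
  define k where "k = max 1 \<lceil>80 * (R + S) / \<delta>\<rceil>"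
  have k: "1 \<le> k" "80 * (R + S) / \<delta> \<le> of_int k"
    by (auto simp: k_def le_max_iff_disj) linarith
  then have k0: "0 < k" "0 < (of_int k :: real)" "1 \<le> (of_int k :: real)" by auto
  have "80 * (R + S) \<le> of_int k * \<delta>" using k(2) \<delta>(1) by (simp add: field_simps)
  also have "\<dots> \<le> of_int k * (of_int k * \<delta>)"
    using mult_right_mono[OF k0(3), of "of_int k * \<delta>"] k0(2) \<delta>(1) by simp
  finally have k_large: "80 * (R + S) \<le> of_int k * (of_int k * \<delta>)" .
  define \<kappa> :: real where "\<kappa> = of_int k"
  note k' = k0(2,3)[folded \<kappa>_def] k_large[folded \<kappa>_def]
  define \<rho> where "\<rho> = 2 * (R + S) / \<kappa>"
  define E where "E = (\<lambda>e. (1 / \<kappa>) *\<^sub>R e) ` E0"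
  \<comment> \<open>Division points of the lattice near 0. The radius is a bound for
    \<open>2 * (\<kappa>\<^sup>2 * R) + 2 * R\<close>, which dominates \<open>q v\<close> in the
    density argument.\<close>
  define C where "C = (\<lambda>u. (1 / \<kappa>) *\<^sub>R u) ` {u \<in> M'. q (0 - u) \<le> 4 * R * \<kappa>\<^sup>2}"
  define A where "A = (\<lambda>(p, e). p + e) ` (C \<times> E)"
  have "finite A"
    unfolding A_def C_def E_def using \<open>finite E0\<close> finite_lattice_ball by blast
  have A_pr: "\<exists>v. \<forall>x. \<kappa> * Q c x = pr v x" if c: "c \<in> A" for c
  proof -
    obtain u e where ue: "u \<in> M'" "e \<in> E0" "c = (1 / \<kappa>) *\<^sub>R u + (1 / \<kappa>) *\<^sub>R e"
      using c by (auto simp: A_def C_def E_def)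
    obtain v where "\<And>x. Q e x = pr v x" using E0_pr[OF ue(2)] by blast
    then have "\<kappa> * Q c x = pr (l u + v) x" for x
      using k'(1) Q_lattice[OF ue(1), of x] by (simp add: ue(3) Q_simps pr_add field_simps)
    then show ?thesis by blast
  qed
  obtain xs where xs: "set xs = A" using \<open>finite A\<close> finite_list by blast
  have dense: "\<exists>p. \<forall>e\<in>E. \<exists>c\<in>A. \<exists>u\<in>M'. c + u = p + e \<and> \<kappa> * q (x - (p + e)) \<le> \<rho>" for x
  proof -
    \<comment> \<open>\<open>u\<close> is a lattice point near \<open>x\<close>, and
      \<open>v\<close> divided by \<open>\<kappa>\<close> approximates the remainder
      \<open>x - u\<close> with squared error at most \<open>R / \<kappa>\<^sup>2\<close>. Their sum
      will be the witness \<open>p\<close>.\<close>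
    obtain u where u: "u \<in> M'" "q (x - u) \<le> R" using R by blast
    obtain v where v: "v \<in> M'" "q (\<kappa> *\<^sub>R (x - u) - v) \<le> R" using R by blast
    have eq: "(1 / \<kappa>) *\<^sub>R (\<kappa> *\<^sub>R (x - u) - v) = x - u - (1 / \<kappa>) *\<^sub>R v"
      using k'(1) by (simp add: algebra_simps)
    have near: "\<kappa>\<^sup>2 * q (x - u - (1 / \<kappa>) *\<^sub>R v) \<le> R"
      using v(2) k'(1) by (simp add: q_scale flip: eq) (simp add: power_divide)
    have "q v \<le> 2 * q (\<kappa> *\<^sub>R (x - u)) + 2 * q (\<kappa> *\<^sub>R (x - u) - v)"
      using q_diff_le[of "\<kappa> *\<^sub>R (x - u)" "\<kappa> *\<^sub>R (x - u) - v"] by simp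
    also have "\<dots> \<le> 2 * (\<kappa>\<^sup>2 * R) + 2 * R"
      using u(2) v(2) by (auto simp: q_scale intro!: add_mono mult_left_mono)
    also have "\<dots> \<le> 4 * R * \<kappa>\<^sup>2"
      using k'(2) \<open>0 \<le> R\<close> mult_left_mono[of 1 "\<kappa>\<^sup>2" "2 * R"] by (simp add: one_le_power algebra_simps)
    finally have "(1 / \<kappa>) *\<^sub>R v \<in> C" using v(1) by (auto simp: C_def q_minus)
    then have A: "(1 / \<kappa>) *\<^sub>R v + e \<in> A" if "e \<in> E" for e
      using that by (auto simp: A_def)
    have "\<kappa> * q (x - ((1 / \<kappa>) *\<^sub>R v + u + e)) \<le> \<rho>" if eE: "e \<in> E" for e
    proof -
      obtain e0 where e0: "e0 \<in> E0" "e = (1 / \<kappa>) *\<^sub>R e0" using eE by (auto simp: E_def)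
      have "\<kappa>\<^sup>2 * q e = q e0" using k'(1) by (simp add: e0(2) q_scale power_divide)
      then have e: "\<kappa>\<^sup>2 * q e \<le> S" using S[OF e0(1)] by simp
      have "q (x - ((1 / \<kappa>) *\<^sub>R v + u + e)) \<le> 2 * q (x - u - (1 / \<kappa>) *\<^sub>R v) + 2 * q e"
        using q_diff_le[of "x - u - (1 / \<kappa>) *\<^sub>R v" e] by (simp add: algebra_simps)
      then have "\<kappa>\<^sup>2 * q (x - ((1 / \<kappa>) *\<^sub>R v + u + e)) \<le>
          \<kappa>\<^sup>2 * (2 * q (x - u - (1 / \<kappa>) *\<^sub>R v) + 2 * q e)"
        by (intro mult_left_mono) auto
      also have "\<dots> \<le> 2 * R + 2 * S" using near e by (simp add: algebra_simps)
      finally show ?thesis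
        using k'(1) by (simp add: \<rho>_def field_simps power2_eq_square)
    qed
    then show ?thesis
      by (intro exI[of _ "(1 / \<kappa>) *\<^sub>R v + u"] ballI bexI[OF _ A] bexI[OF _ u(1)]) simp_all
  qed
  have zero_E: "0 \<in> E" unfolding E_def by (rule image_eqI[of _ _ 0]) (simp_all add: E0_def)
  have "A \<noteq> {}" using dense[of 0] zero_E by blast
  then have "xs \<noteq> []" using xs by auto
  \<comment> \<open>Sections are numbered from 0 to \<open>m\<close> inclusive, so
    \<open>m = length xs - 1\<close>, which is correct only for a nonempty list.\<close>
  then have "{..<length xs} = {..length xs - 1}" by (cases xs) auto
  then have A_eq: "A = (\<lambda>i. xs ! i) ` {..length xs - 1}"
    unfolding xs[symmetric] set_conv_nth by auto
  have index: "(\<exists>c\<in>A. F c) \<longleftrightarrow> (\<exists>i\<le>length xs - 1. F (xs ! i))" for F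
    unfolding A_eq by auto
  interpret k: polarized_lattice B M' pr "\<lambda>x y. \<kappa> * Q x y" "\<lambda>u. zscale k (l u)"
    unfolding \<kappa>_def by (rule scaled[OF module k0(1)])
  have kq: "k.q x = \<kappa> * q x" for x by (simp add: k.q_def q_def)
  have "\<exists>w. \<forall>i\<in>{..length xs - 1}. \<forall>x. \<kappa> * Q (xs ! i) x = pr (w i) x"
  proof (rule bchoice, rule ballI)
    fix i assume "i \<in> {..length xs - 1}"
    then have "xs ! i \<in> A" unfolding A_eq by blast
    then show "\<exists>v. \<forall>x. \<kappa> * Q (xs ! i) x = pr v x" by (rule A_pr)
  qed
  then obtain w where w: "\<And>i x. i \<le> length xs - 1 \<Longrightarrow> \<kappa> * Q (xs ! i) x = pr (w i) x" by auto
  interpret f: fine_theta_data B M' pr "\<lambda>x y. \<kappa> * Q x y" "\<lambda>u. zscale k (l u)"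
    "length xs - 1" "\<lambda>i. xs ! i" w E \<rho>
  proof
    show "0 \<in> E" by (rule zero_E)
    show "\<exists>p. \<forall>e\<in>E. \<exists>i\<le>length xs - 1. \<exists>u\<in>M'. xs ! i + u = p + e \<and> k.q (x - (p + e)) \<le> \<rho>" for x
      using dense[of x] unfolding index kq .
    show "40 * \<rho> < k.q u" if "u \<in> M'" "u \<noteq> 0" for u
    proof -
      have "40 * \<rho> \<le> \<kappa> * \<delta>" using k' by (simp add: \<rho>_def field_simps)
      also have "\<dots> < \<kappa> * q u" using \<delta>(2)[OF that] k'(1) by simp
      finally show ?thesis by (simp add: kq)
    qed
    show "\<exists>j. pr v x = t * of_int j" if E: "\<And>e. e \<in> E \<Longrightarrow> \<exists>j. \<kappa> * Q e x = t * of_int j" for x t v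
    proof -
      have "v \<in> span BM" by (simp add: BM)
      then show ?thesis
      proof (rule span_induct)
        show "subspace {v. \<exists>j. pr v x = t * of_int j}"
        proof (rule subspaceI)
          show "0 \<in> {v. \<exists>j. pr v x = t * of_int j}"
            by (auto simp: pr_0 intro: exI[of _ 0])
          fix v v' assume "v \<in> {v. \<exists>j. pr v x = t * of_int j}" "v' \<in> {v. \<exists>j. pr v x = t * of_int j}"
          then obtain j j' where "pr v x = t * of_int j" "pr v' x = t * of_int j'" by blast
          then show "v + v' \<in> {v. \<exists>j. pr v x = t * of_int j}"
            by (auto simp: pr_add algebra_simps intro!: exI[of _ "j + j'"])
        next
          fix c v assume "v \<in> {v. \<exists>j. pr v x = t * of_int j}"
          then obtain j where "pr v x = t * of_int j" by blast
          then show "zscale c v \<in> {v. \<exists>j. pr v x = t * of_int j}"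
            by (auto simp: pr_zscale[OF module] intro!: exI[of _ "c * j"])
        qed
        fix v assume "v \<in> BM"
        then have "(1 / \<kappa>) *\<^sub>R r v \<in> E" unfolding E_def E0_def by blast
        from E[OF this] show "\<exists>j. pr v x = t * of_int j"
          using k'(1) by (simp add: Q_simps r)
      qed
    qed
  qed (rule w)
  show ?thesis
    using k.tropical_descent_datum f.admits_faithful_embedding by blast
qed

end

section \<open>From injective sections to a polarization\<close>

context lattice_basis
begin

lemma lattice_sum: "(\<And>i. i \<in> I \<Longrightarrow> f i \<in> M') \<Longrightarrow> sum f I \<in> M'"
  by (induction I rule: infinite_finite_induct) (auto intro: lattice_add)

lemma additive_on_lattice:
  fixes F :: "'v \<Rightarrow> real"
  assumes add: "\<And>u v. u \<in> M' \<Longrightarrow> v \<in> M' \<Longrightarrow> F (u + v) = F u + F v"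
    and u: "u \<in> M'"
  shows "F u = (\<Sum>b\<in>B. coord u b * F b)"
proof -
  have F0: "F 0 = 0" using add[of 0 0] by simp
  have F_minus: "F (- v) = - F v" if "v \<in> M'" for v
    using add[OF that lattice_minus[OF that]] F0 by simp
  have nat: "F (of_nat n *\<^sub>R v) = of_nat n * F v" if "v \<in> M'" for n v
  proof (induction n)
    case (Suc n)
    have "of_nat n *\<^sub>R v \<in> M'" using lattice_scale[OF that, of "int n"] by simp
    moreover have "of_nat (Suc n) *\<^sub>R v = of_nat n *\<^sub>R v + v" by (simp add: scaleR_add_left)
    ultimately have "F (of_nat (Suc n) *\<^sub>R v) = F (of_nat n *\<^sub>R v) + F v"
      by (simp only: add[OF _ that])
    then show ?case by (simp only: Suc) (simp add: algebra_simps)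
  qed (simp add: F0)
  have int: "F (of_int k *\<^sub>R v) = of_int k * F v" if v: "v \<in> M'" for k v
  proof (cases k)
    case (neg n)
    then have "of_int k *\<^sub>R v = of_nat (Suc n) *\<^sub>R (- v)"
      by (simp only: of_int_minus of_int_of_nat_eq scaleR_minus_left scaleR_minus_right)
    then have "F (of_int k *\<^sub>R v) = of_nat (Suc n) * - F v"
      by (simp only: nat[OF lattice_minus[OF v]] F_minus[OF v])
    then show ?thesis by (simp only: neg of_int_minus of_int_of_nat_eq mult_minus_left mult_minus_right)
  qed (use nat[OF v] in simp)
  have "F (\<Sum>b\<in>S. of_int (c b) *\<^sub>R b) = (\<Sum>b\<in>S. of_int (c b) * F b)" if "S \<subseteq> B" for S and c :: "'v \<Rightarrow> int"
    using finite_subset[OF that finite_B] that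
  proof (induction S rule: finite_induct)
    case (insert b S)
    have "of_int (c b) *\<^sub>R b \<in> M'" using insert.prems by (intro lattice_scale lattice_basis) auto
    moreover have "(\<Sum>b\<in>S. of_int (c b) *\<^sub>R b) \<in> M'"
      using insert.prems by (intro lattice_sum lattice_scale lattice_basis) auto
    moreover have "b \<in> M'" using insert.prems lattice_basis by auto
    ultimately show ?case using insert by (simp add: add int)
  qed (simp add: F0)
  then have *: "F (\<Sum>b\<in>B. of_int (c b) *\<^sub>R b) = (\<Sum>b\<in>B. of_int (c b) * F b)" for c :: "'v \<Rightarrow> int"
    by blast
  obtain c :: "'v \<Rightarrow> int" where c: "u = (\<Sum>b\<in>B. of_int (c b) *\<^sub>R b)"
    using u unfolding lattice_eq by blast
  show ?thesis using *[of c] by (simp add: c coord_of_sum)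
qed

text \<open>Rounding the coordinates of \<open>k x\<close> down and dividing by \<open>k\<close>
  approximates \<open>x\<close> by multiples of lattice vectors. Such multiples have nonnegative
  form, and the sign passes to the limit.\<close>

lemma quadratic_form_nonneg:
  assumes Q: "bilinear Q" and lat: "\<And>u. u \<in> M' \<Longrightarrow> 0 \<le> (Q u u :: real)"
  shows "0 \<le> Q x x"
proof -
  have expand: "Q (\<Sum>b\<in>B. c b *\<^sub>R b) (\<Sum>b\<in>B. c b *\<^sub>R b) = (\<Sum>(b, b')\<in>B \<times> B. c b * c b' * Q b b')" for c
    by (simp add: bilinear_sum[OF Q] bilinear_lmul[OF Q] bilinear_rmul[OF Q] mult_ac)
  define c where "c k b = of_int \<lfloor>real k * coord x b\<rfloor> / real k" for k b
  have "(\<lambda>k. c k b) \<longlonglongrightarrow> coord x b" for b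
  proof (rule LIM_zero_cancel, rule Lim_null_comparison[OF _ lim_1_over_n])
    have "norm (c k b - coord x b) \<le> 1 / of_nat k" if "k > 0" for k
    proof -
      have "\<bar>of_int \<lfloor>real k * coord x b\<rfloor> - real k * coord x b\<bar> \<le> 1" by linarith
      then have "\<bar>of_int \<lfloor>real k * coord x b\<rfloor> - real k * coord x b\<bar> / real k \<le> 1 / real k"
        by (intro divide_right_mono) auto
      moreover have "c k b - coord x b = (of_int \<lfloor>real k * coord x b\<rfloor> - real k * coord x b) / real k"
        using that by (simp add: c_def diff_divide_distrib)
      ultimately show ?thesis by simp
    qed
    then show "\<forall>\<^sub>F k in sequentially. norm (c k b - coord x b) \<le> 1 / of_nat k"
      by (intro eventually_sequentiallyI[of 1]) auto
  qed
  then have "(\<lambda>k. \<Sum>(b, b')\<in>B \<times> B. c k b * c k b' * Q b b')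
      \<longlonglongrightarrow> (\<Sum>(b, b')\<in>B \<times> B. coord x b * coord x b' * Q b b')"
    unfolding case_prod_beta by (intro tendsto_intros)
  also have "(\<Sum>(b, b')\<in>B \<times> B. coord x b * coord x b' * Q b b') = Q x x"
    unfolding expand[symmetric] coord_sum ..
  finally have lim: "(\<lambda>k. \<Sum>(b, b')\<in>B \<times> B. c k b * c k b' * Q b b') \<longlonglongrightarrow> Q x x" .
  have "0 \<le> (\<Sum>(b, b')\<in>B \<times> B. c k b * c k b' * Q b b')" for k
  proof -
    let ?u = "\<Sum>b\<in>B. of_int \<lfloor>real k * coord x b\<rfloor> *\<^sub>R b"
    have "(\<Sum>b\<in>B. c k b *\<^sub>R b) = (1 / real k) *\<^sub>R ?u"
      by (simp add: c_def scaleR_sum_right)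
    then have "(\<Sum>(b, b')\<in>B \<times> B. c k b * c k b' * Q b b') = (1 / real k) * ((1 / real k) * Q ?u ?u)"
      unfolding expand[symmetric] by (simp add: bilinear_lmul[OF Q] bilinear_rmul[OF Q])
    moreover have "0 \<le> Q ?u ?u" by (intro lat lattice_combination)
    ultimately show ?thesis by simp
  qed
  then show ?thesis by (intro LIMSEQ_le_const[OF lim]) auto
qed

end

text \<open>On the line \<open>y + t *\<^sub>R x\<close> the form is affine in \<open>t\<close>,
  since \<open>Q x x = 0\<close>. With \<open>Q x y \<noteq> 0\<close> it would be unbounded below;
  the chosen \<open>t\<close> makes it \<open>- 1\<close>.\<close>

lemma semidefinite_kernel:
  assumes Q: "bilinear Q" and sym: "\<And>x y. Q x y = Q y x"
    and nonneg: "\<And>x. 0 \<le> (Q x x :: real)" and x: "Q x x = 0"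
  shows "Q x y = 0"
proof (rule ccontr)
  assume s: "Q x y \<noteq> 0"
  define t where "t = - (Q y y + 1) / (2 * Q x y)"
  have "0 \<le> Q (y + t *\<^sub>R x) (y + t *\<^sub>R x)" by (rule nonneg)
  also have "\<dots> = Q y y + 2 * t * Q x y"
    using x sym[of y x]
    by (simp add: bilinear_ladd[OF Q] bilinear_radd[OF Q] bilinear_lmul[OF Q] bilinear_rmul[OF Q])
  also have "\<dots> = - 1" using s by (simp add: t_def field_simps)
  finally show False by simp
qed

text \<open>If the form degenerates, so does \<open>l\<close>: approximating a multiple of a kernel vector \<open>x\<close> by a
  lattice vector \<open>u\<close> makes the integral coordinates of \<open>l u\<close> smaller than 1.\<close>

lemma lattice_kernel_vector:
  fixes zscale :: "int \<Rightarrow> 'm::ab_group_add \<Rightarrow> 'm"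
    and pr :: "'m \<Rightarrow> 'v::real_normed_vector \<Rightarrow> real"
  assumes "lattice_basis B M'" "is_real_dual pr" "free_Z_module_of_rank zscale n"
    and Q: "bilinear Q" and Q_lattice: "\<And>u y. u \<in> M' \<Longrightarrow> Q u y = pr (l u) y"
    and x: "x \<noteq> 0" "\<And>y. Q x y = 0"
  shows "\<exists>u\<in>M'. u \<noteq> 0 \<and> l u = 0"
proof -
  interpret lattice_basis B M' by fact
  interpret real_dual pr by unfold_locales fact
  interpret M: module zscale using assms(3) by (simp add: free_Z_module_of_rank_def)
  obtain BM where BM: "finite BM" "\<not> M.dependent BM" "M.span BM = UNIV"
    using assms(3) by (auto simp: free_Z_module_of_rank_def)
  \<comment> \<open>The dual basis of \<open>BM\<close>, realized by points.\<close>
  have "\<exists>y. \<forall>v. pr v y = of_int (M.representation BM v e)" for e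
  proof -
    have "Modules.additive (\<lambda>v. real_of_int (M.representation BM v e))"
      by unfold_locales (simp add: M.representation_add BM)
    from exists_point[OF this] show ?thesis by blast
  qed
  then have "\<exists>Y. \<forall>e v. pr v (Y e) = of_int (M.representation BM v e)" by (intro choice allI)
  then obtain Y where Y: "\<And>e v. pr v (Y e) = of_int (M.representation BM v e)" by blast
  obtain b0 where b0: "b0 \<in> B" "coord x b0 \<noteq> 0"
    using coord_ext[of x 0] x(1) coord_simps(4) by auto
  \<comment> \<open>With coordinate 1 at \<open>b0\<close>, the approximation of \<open>k z\<close>
    has integral coordinate exactly \<open>k\<close> there, so the lattice vector obtained is
    nonzero.\<close>
  define z where "z = (1 / coord x b0) *\<^sub>R x"
  have z: "coord z b0 = 1" "Q z y = 0" for y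
    using b0 x(2) by (simp_all add: z_def coord_simps bilinear_lmul[OF Q])
  \<comment> \<open>Summing over all of \<open>BM\<close> lets one precision \<open>N > S\<close>
    force every coordinate of \<open>l u\<close> below 1 in absolute value.\<close>
  define S where "S = (\<Sum>e\<in>BM. \<Sum>b\<in>B. \<bar>Q b (Y e)\<bar>)"
  have "0 \<le> S" unfolding S_def by (intro sum_nonneg) auto
  define N where "N = nat \<lceil>S\<rceil> + 1"
  have N: "N > 0" "S < of_nat N" using \<open>0 \<le> S\<close> by (auto simp: N_def) linarith
  obtain f where f: "bij_betw f {0..<card B} B"
    using ex_bij_betw_nat_finite[OF finite_B] by blast
  obtain k p where kp: "0 < k"
    "\<And>i. i < card B \<Longrightarrow> \<bar>of_int k * coord z (f i) - of_int (p i)\<bar> < 1 / N"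
    using Dirichlet_approx_simult[OF N(1), of "card B" "\<lambda>i. coord z (f i)"] by blast
  define c where "c b = p (inv_into {0..<card B} f b)" for b
  have c: "\<bar>of_int k * coord z b - of_int (c b)\<bar> < 1 / N" if "b \<in> B" for b
  proof -
    let ?i = "inv_into {0..<card B} f b"
    have "?i < card B" "f ?i = b"
      using f that inv_into_into[of b f "{0..<card B}"] f_inv_into_f[of b f "{0..<card B}"]
      by (simp_all add: bij_betw_def)
    then show ?thesis using kp(2)[of ?i] by (simp add: c_def)
  qed
  define u where "u = (\<Sum>b\<in>B. of_int (c b) *\<^sub>R b)"
  have u: "u \<in> M'" unfolding u_def by (rule lattice_combination)
  have "\<bar>of_int k - real_of_int (c b0)\<bar> < 1"
  proof -
    have "1 / real N \<le> 1" using N(1) by simp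
    then show ?thesis using c[OF b0(1)] unfolding z(1) by linarith
  qed
  then have "c b0 = k" by linarith
  then have "coord u b0 = of_int k" unfolding u_def by (simp only: coord_of_sum[OF b0(1)])
  then have "u \<noteq> 0" using kp(1) coord_simps(4)[of b0] by auto
  have "M.representation BM (l u) e = 0" if e: "e \<in> BM" for e
  proof -
    have "of_int (M.representation BM (l u) e) = Q u (Y e)"
      unfolding Q_lattice[OF u] Y ..
    also have "\<dots> = Q (u - of_int k *\<^sub>R z) (Y e)"
      unfolding bilinear_lsub[OF Q] bilinear_lmul[OF Q] z(2) by simp
    also have "\<dots> = (\<Sum>b\<in>B. coord (u - of_int k *\<^sub>R z) b * Q b (Y e))"
    proof -
      have "linear (\<lambda>w. Q w (Y e))" using Q by (simp add: bilinear_def)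
      from linear_expand[OF this, of "u - of_int k *\<^sub>R z"] show ?thesis by simp
    qed
    finally have "\<bar>real_of_int (M.representation BM (l u) e)\<bar> =
        \<bar>\<Sum>b\<in>B. coord (u - of_int k *\<^sub>R z) b * Q b (Y e)\<bar>"
      by (rule arg_cong)
    also have "\<dots> \<le> (\<Sum>b\<in>B. \<bar>coord (u - of_int k *\<^sub>R z) b\<bar> * \<bar>Q b (Y e)\<bar>)"
      unfolding abs_mult[symmetric] by (rule sum_abs)
    also have "\<dots> \<le> (\<Sum>b\<in>B. (1 / N) * \<bar>Q b (Y e)\<bar>)"
    proof (intro sum_mono mult_right_mono)
      fix b assume b: "b \<in> B"
      have "coord (u - of_int k *\<^sub>R z) b = - (of_int k * coord z b - of_int (c b))"
        unfolding coord_simps(2,5) u_def coord_of_sum[OF b] by simp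
      then show "\<bar>coord (u - of_int k *\<^sub>R z) b\<bar> \<le> 1 / N" using c[OF b] by linarith
    qed simp
    also have "\<dots> = (1 / N) * (\<Sum>b\<in>B. \<bar>Q b (Y e)\<bar>)" by (rule sum_distrib_left[symmetric])
    also have "\<dots> \<le> (1 / N) * S"
    proof (rule mult_left_mono)
      show "(\<Sum>b\<in>B. \<bar>Q b (Y e)\<bar>) \<le> S"
        unfolding S_def
        by (rule member_le_sum[of e BM "\<lambda>e. \<Sum>b\<in>B. \<bar>Q b (Y e)\<bar>"]) (use e BM(1) in \<open>simp_all add: sum_nonneg\<close>)
    qed simp
    also have "\<dots> < 1" using N by (simp add: field_simps)
    finally show ?thesis by linarith
  qed
  then have "l u = 0"
  proof -
    have "(\<Sum>e\<in>BM. zscale (M.representation BM (l u) e) e) = l u"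
      using BM by (intro M.sum_representation_eq) simp_all
    moreover have "(\<Sum>e\<in>BM. zscale (M.representation BM (l u) e) e) = 0"
      using \<open>\<And>e. e \<in> BM \<Longrightarrow> M.representation BM (l u) e = 0\<close> by (intro sum.neutral) simp
    ultimately show ?thesis by simp
  qed
  then show ?thesis using u \<open>u \<noteq> 0\<close> by blast
qed

text \<open>Concavity between 0 and \<open>u\<close> gives the lower bound. For the upper bound,
  \<open>u\<close> is the combination of \<open>t *\<^sub>R u\<close> and
  \<open>t *\<^sub>R u + u\<close> with weights \<open>t\<close> and \<open>1 - t\<close>, and the
  period relates the values at these two points.\<close>

lemma concave_affine_periodic:
  fixes g :: "'v::real_vector \<Rightarrow> real"
  assumes g: "concave_on UNIV g" and period: "\<And>x. g (x + u) = g x - c" and t: "0 < t" "t < 1"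
  shows "g (t *\<^sub>R u) = g 0 - t * c"
proof (rule antisym)
  have g': "(1 - s) * g a + s * g b \<le> g ((1 - s) *\<^sub>R a + s *\<^sub>R b)" if "0 \<le> s" "s \<le> 1" for s a b
    using concave_onD[OF g that] by simp
  have gu: "g u = g 0 - c" using period[of 0] by simp
  show "g 0 - t * c \<le> g (t *\<^sub>R u)"
    using g'[of t 0 u] t gu by (simp add: algebra_simps)
  have "(1 - (1 - t)) * g (t *\<^sub>R u) + (1 - t) * g (t *\<^sub>R u + u) \<le>
      g ((1 - (1 - t)) *\<^sub>R (t *\<^sub>R u) + (1 - t) *\<^sub>R (t *\<^sub>R u + u))"
    using t by (intro g') auto
  also have "(1 - (1 - t)) *\<^sub>R (t *\<^sub>R u) + (1 - t) *\<^sub>R (t *\<^sub>R u + u) = u"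
    by (simp add: algebra_simps)
  finally have "t * g (t *\<^sub>R u) + (1 - t) * (g (t *\<^sub>R u) - c) \<le> g 0 - c"
    unfolding period gu by simp
  then show "g (t *\<^sub>R u) \<le> g 0 - t * c"
    by (simp add: algebra_simps)
qed

lemma tropical_abelian_variety_if_injective:
  fixes zscale :: "int \<Rightarrow> 'm::ab_group_add \<Rightarrow> 'm"
    and pr :: "'m \<Rightarrow> 'v::real_normed_vector \<Rightarrow> real"
  assumes "free_Z_module_of_rank zscale n" "is_real_dual pr" "full_lattice M'"
    and datum: "tropical_descent_datum pr M' l \<gamma>"
    and s: "finite_sections pr M' l \<gamma> m s"
    and inj: "inj_on (torus_map m s) (torus M')"
  shows "tropical_abelian_variety pr M'"
proof -
  obtain B where B: "lattice_basis B M'" using full_lattice_basis[OF assms(3)] .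
  interpret lattice_basis B M' by fact
  interpret real_dual pr by unfold_locales fact
  have hom: "hom_on M' l" and l_add: "\<And>u v. u \<in> M' \<Longrightarrow> v \<in> M' \<Longrightarrow> l (u + v) = l u + l v"
    and \<gamma>: "\<And>u v. u \<in> M' \<Longrightarrow> v \<in> M' \<Longrightarrow> \<gamma> (u + v) - \<gamma> u - \<gamma> v = pr (l v) u"
    using datum by (auto simp: tropical_descent_datum_def hom_on_def)
  \<comment> \<open>The left side of the relation for \<open>\<gamma>\<close> is symmetric in
    \<open>u\<close> and \<open>v\<close>.\<close>
  have sym: "pr (l u) v = pr (l v) u" if "u \<in> M'" "v \<in> M'" for u v
    using \<gamma>[OF that] \<gamma>[OF that(2,1)] by (simp add: add.commute)
  define Q where "Q x y = (\<Sum>b\<in>B. coord x b * pr (l b) y)" for x y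
  have Q: "bilinear Q"
    unfolding bilinear_def Q_def
    by (intro conjI allI linearI)
      (simp_all add: coord_simps linear_add[OF linear_pr] linear_scale[OF linear_pr]
        algebra_simps sum.distrib sum_distrib_left)
  have Q_lattice: "Q u y = pr (l u) y" if "u \<in> M'" for u y
    unfolding Q_def
    by (rule additive_on_lattice[symmetric, of "\<lambda>u. pr (l u) y"]) (auto simp: that l_add pr_add)
  have Q_sym: "Q x y = Q y x" for x y
    by (rule bilinear_symI[OF Q]) (simp add: Q_lattice sym lattice_basis)
  have "\<exists>g. concave_on UNIV g \<and> s i = (\<lambda>x. ereal (g x)) \<and>
      (\<forall>x. \<forall>u\<in>M'. g (x + u) = g x - pr (l u) x - \<gamma> u)" if "i \<le> m" for i
  proof -
    have si: "s i \<in> H0 pr M' l \<gamma>" "s i \<noteq> (\<lambda>_. \<infinity>)"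
      using s that by (auto simp: finite_sections_def)
    then obtain g where g: "concave_on UNIV g" "s i = (\<lambda>x. ereal (g x))"
      by (auto simp: H0_def regular_function_def)
    moreover have "g (x + u) = g x - pr (l u) x - \<gamma> u" if "u \<in> M'" for x u
      using si(1) that by (auto simp: H0_def g(2))
    ultimately show ?thesis by blast
  qed
  then have "\<exists>g. \<forall>i\<in>{..m}. concave_on UNIV (g i) \<and> s i = (\<lambda>x. ereal (g i x)) \<and>
      (\<forall>x. \<forall>u\<in>M'. g i (x + u) = g i x - pr (l u) x - \<gamma> u)"
    by (intro bchoice ballI) simp
  then obtain g where g: "\<And>i. i \<le> m \<Longrightarrow> concave_on UNIV (g i)"
    "\<And>i. i \<le> m \<Longrightarrow> s i = (\<lambda>x. ereal (g i x))"
    "\<And>i x u. i \<le> m \<Longrightarrow> u \<in> M' \<Longrightarrow> g i (x + u) = g i x - pr (l u) x - \<gamma> u"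
    by auto
  \<comment> \<open>Quasi-periodicity turns \<open>g 0 u + g 0 (- u)\<close> into
    \<open>2 * g 0 0 - Q u u\<close>; concavity at the midpoint 0 gives the sign.\<close>
  have "0 \<le> Q u u" if u: "u \<in> M'" for u
  proof -
    have "g 0 0 = g 0 (- u) + pr (l u) u - \<gamma> u"
      using g(3)[of 0 u "- u"] u by (simp add: linear_neg[OF linear_pr])
    moreover have "g 0 u = g 0 0 - \<gamma> u"
      using g(3)[of 0 u 0] u by (simp add: linear_0[OF linear_pr])
    moreover have "g 0 u / 2 + g 0 (- u) / 2 \<le> g 0 0"
      using concave_onD[OF g(1)[of 0], of "1 / 2" u "- u"] by simp
    ultimately show ?thesis unfolding Q_lattice[OF u] by linarith
  qed
  then have nonneg: "0 \<le> Q x x" for x by (rule quadratic_form_nonneg[OF Q])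
  have "0 < Q x x" if x: "x \<noteq> 0" for x
  proof (rule ccontr)
    assume "\<not> 0 < Q x x"
    then have "Q x x = 0" using nonneg[of x] by linarith
    then have "Q x y = 0" for y by (rule semidefinite_kernel[OF Q Q_sym nonneg])
    then obtain u where u: "u \<in> M'" "u \<noteq> 0" "l u = 0"
      using lattice_kernel_vector[OF B assms(2,1) Q Q_lattice x] by blast
    obtain b where b: "b \<in> B" "coord u b \<noteq> 0"
      using coord_ext[of u 0] u(2) coord_simps(4) by auto
    then obtain k where k: "coord u b = of_int k"
      using u(1) by (auto simp: lattice_iff elim: Ints_cases)
    \<comment> \<open>Makes the coordinate of \<open>t *\<^sub>R u\<close> at \<open>b\<close> equal
      to 1/2 up to sign, so that this point is not in the lattice, although all sections change by
      the same amount \<open>- t * \<gamma> u\<close> between 0 and it.\<close>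
    define t :: real where "t = 1 / (2 * of_int \<bar>k\<bar>)"
    have "k \<noteq> 0" using b(2) k by simp
    then have k1: "1 \<le> real_of_int \<bar>k\<bar>" by linarith
    then have t: "0 < t" "t < 1" by (auto simp: t_def field_simps)
    have gi: "g i (t *\<^sub>R u) = g i 0 - t * \<gamma> u" if "i \<le> m" for i
      by (rule concave_affine_periodic[OF g(1)[OF that] _ t])
        (simp only: g(3)[OF that u(1)] u(3) pr_0 diff_zero)
    have "torus_map m s (torus_proj M' (t *\<^sub>R u)) = torus_map m s (torus_proj M' 0)"
      unfolding torus_map_torus_proj[OF assms(3) s]
      by (auto simp: proj_coords_def g(2) gi)
    then have "torus_proj M' (t *\<^sub>R u) = torus_proj M' 0"
      by (rule inj_onD[OF inj]) (auto simp: torus_def)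
    then have "t *\<^sub>R u \<in> M'" by (simp add: torus_proj_eq_iff)
    then have "t * of_int k \<in> \<int>" using b(1) by (auto simp: lattice_iff coord_simps k)
    then obtain j where j: "t * of_int k = of_int j" by (rule Ints_cases)
    have "t * of_int \<bar>k\<bar> = 1 / 2" using k1 by (simp add: t_def)
    moreover have "\<bar>t * of_int k\<bar> = t * of_int \<bar>k\<bar>" using t(1) by (simp add: abs_mult)
    ultimately have "\<bar>real_of_int j\<bar> = 1 / 2" unfolding j by simp
    then have "2 * \<bar>j\<bar> = 1" by linarith
    then show False by presburger
  qed
  then show ?thesis
    unfolding tropical_abelian_variety_def using hom sym Q Q_lattice
    by (intro exI[of _ l] exI[of _ Q] conjI) simp_all
qed

section \<open>The equivalence\<close>

theorem corollary4p7:
  fixes zscale :: "int \<Rightarrow> 'm::ab_group_add \<Rightarrow> 'm"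
    and n :: nat
    and pr :: "'m \<Rightarrow> 'v::real_normed_vector \<Rightarrow> real"
    and M' :: "'v set"
  assumes "free_Z_module_of_rank zscale n"
    and "is_real_dual pr"
    and "full_lattice M'"
  shows "(tropical_abelian_variety pr M' \<longleftrightarrow>
            (\<exists>l \<gamma>. tropical_descent_datum pr M' l \<gamma> \<and> admits_faithful_embedding pr M' l \<gamma>)) \<and>
         ((\<exists>l \<gamma>. tropical_descent_datum pr M' l \<gamma> \<and> admits_faithful_embedding pr M' l \<gamma>) \<longleftrightarrow>
            (\<exists>l \<gamma>. tropical_descent_datum pr M' l \<gamma> \<and>
               (\<exists>m s. finite_sections pr M' l \<gamma> m s \<and> inj_on (torus_map m s) (torus M'))))"
proof -
  have embedding_inj: "inj_on \<phi> (torus M')"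
    if "embedding_map (torus_topology M') (Euclidean_space m) \<phi>" for m \<phi>
    using homeomorphic_imp_injective_map that
    unfolding embedding_map_def topspace_torus_topology[symmetric] by blast
  have to_embedding: "\<exists>l \<gamma>. tropical_descent_datum pr M' l \<gamma> \<and> admits_faithful_embedding pr M' l \<gamma>"
    if variety: "tropical_abelian_variety pr M'"
  proof -
    obtain B where B: "lattice_basis B M'" using full_lattice_basis[OF assms(3)] .
    obtain l Q where "hom_on M' l" "bilinear Q"
      and sym: "\<forall>u\<in>M'. \<forall>v\<in>M'. pr (l u) v = pr (l v) u"
      and Q: "\<forall>u\<in>M'. \<forall>v\<in>M'. Q u v = pr (l u) v"
      and pos: "\<forall>x. x \<noteq> 0 \<longrightarrow> (Q x x :: real) > 0"
      using variety unfolding tropical_abelian_variety_def by auto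
    have "polarized_lattice B M' pr Q l"
      by (rule polarized_latticeI[OF B assms(2) \<open>hom_on M' l\<close> \<open>bilinear Q\<close>])
        (use sym Q pos in simp_all)
    then show ?thesis by (rule polarized_lattice.exists_faithful_embedding[OF _ assms(1)])
  qed
  have to_injective: "\<exists>m s. finite_sections pr M' l \<gamma> m s \<and> inj_on (torus_map m s) (torus M')"
    if "admits_faithful_embedding pr M' l \<gamma>" for l \<gamma>
    using that embedding_inj unfolding admits_faithful_embedding_def faithful_embedding_def by blast
  show ?thesis
    using to_embedding to_injective tropical_abelian_variety_if_injective[OF assms] by blast
qed

end
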